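(* Let $n\ge 3$ and let $J_n=\mathrm{Jac}(\Delta(n;1,1,1))$ be the Jacobian group of the graph $\Delta(n;1,1,1)$ (isomorphic to the Cartesian product $C_3\times C_n$ of cycles). Then $$J_n\cong \mathbb{Z}_{\frac{\gcd(n,\nu(n))}{\gcd(n,3)}}\oplus\mathbb{Z}_{\nu(n)}^2\oplus\mathbb{Z}_{\widehat{\mu}(n)\nu(n)}\oplus\mathbb{Z}_{3\mu(n)\,\mathrm{lcm}(n,\nu(n))},$$ where $\mu(n)=1$ for $n$ odd and $\mu(n)=7$ for $n$ even, and $\widehat{\mu}(n)=\gcd(n,3)\mu(n)$.
   Context: $\Delta(n;1,1,1)$ has vertices $v_{x,y}$, $x\in\{1,2,3\}$, $y\in\mathbb{Z}/n\mathbb{Z}$; $v_{x,y}$ is adjacent to $v_{x,y\pm1}$, and for each $y$ the vertices $v_{1,y},v_{2,y},v_{3,y}$ form a triangle. The Jacobian group of a connected graph $G$ is the torsion subgroup of $\mathrm{coker}(L(G))=\mathbb{Z}^{|V(G)|}/L(G)\mathbb{Z}^{|V(G)|}$, where $L(G)$ is the Laplacian (degree matrix minus adjacency matrix). $\mathbb{Z}_d$ denotes the cyclic group of order $d$ ($\mathbb{Z}_1$ trivial). Let $U_{m-1}(x)=\frac{\sin(m\arccos x)}{\sin(\arccos x)}$ be the Chebyshev polynomial of the second kind; at $x=5/2$ this equals $\frac{t^{m}-t^{-m}}{t-t^{-1}}$ with $t=\frac{5+\sqrt{21}}{2}$ and $t^{1/2}=\frac{\sqrt7+\sqrt3}{2}$,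 which also defines it for half-integer $m$. Define $\nu(n)=\sqrt7\,U_{\frac n2-1}(\tfrac52)$ if $n$ is odd and $\nu(n)=U_{\frac n2-1}(\tfrac52)$ if $n$ is even; $\nu(n)$ is a nonnegative integer for all $n\ge0$. *)

theory Defs
  imports
    "HOL-Algebra.Coset"
    "HOL-Algebra.Elementary_Groups"
    "HOL-Algebra.Product_Groups"
    "HOL-Analysis.Complex_Transcendental"
    "HOL-Number_Theory.Cong"
    "Graph_Theory.Digraph_Component"
begin

section \<open>The Jacobian group of a finite simple graph\<close>

text \<open>
  Simple graphs are represented as symmetric loop-free pair digraphs
  (locale \<^locale>\<open>pair_graph\<close>): every edge is a pair of opposite arcs, so the degree
  of a vertex is its out-degree.
\<close>

definition laplacian :: "'a pair_pre_digraph \<Rightarrow> 'a \<Rightarrow> 'a \<Rightarrow> int" where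
  "laplacian G u v =
     (if u = v then int (out_degree (with_proj G) u) else 0) - (if (u, v) \<in> parcs G then 1 else 0)"

text \<open>The group of integer vectors indexed by the vertices (functions extensional on the vertex set).\<close>

definition int_vectors :: "'a pair_pre_digraph \<Rightarrow> ('a \<Rightarrow> int) monoid" where
  "int_vectors G = product_group (pverts G) (\<lambda>_. integer_group)"

definition laplacian_map :: "'a pair_pre_digraph \<Rightarrow> ('a \<Rightarrow> int) \<Rightarrow> ('a \<Rightarrow> int)" where
  "laplacian_map G z = (\<lambda>u\<in>pverts G. \<Sum>v\<in>pverts G. laplacian G u v * z v)"

definition laplacian_coker :: "'a pair_pre_digraph \<Rightarrow> ('a \<Rightarrow> int) set monoid" where
  "laplacian_coker G = int_vectors G Mod (laplacian_map G ` carrier (int_vectors G))"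

definition torsion_elements :: "('a, 'b) monoid_scheme \<Rightarrow> 'a set" where
  "torsion_elements G = {x \<in> carrier G. \<exists>k::nat. k > 0 \<and> x [^]\<^bsub>G\<^esub> k = \<one>\<^bsub>G\<^esub>}"

definition Jac :: "'a pair_pre_digraph \<Rightarrow> ('a \<Rightarrow> int) set monoid" where
  "Jac G = (laplacian_coker G)\<lparr>carrier := torsion_elements (laplacian_coker G)\<rparr>"

lemma comm_group_int_vectors: "comm_group (int_vectors G)"
proof (rule group.group_comm_groupI)
  show "group (int_vectors G)"
    by (simp add: int_vectors_def)
qed (auto simp: int_vectors_def product_group_def)

lemma laplacian_map_hom: "laplacian_map G \<in> hom (int_vectors G) (int_vectors G)"
  by (auto simp: hom_def int_vectors_def product_group_def laplacian_map_def PiE_iff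
      distrib_left sum.distrib intro!: restrict_ext)

lemma laplacian_image_normal: "laplacian_map G ` carrier (int_vectors G) \<lhd> int_vectors G"
proof -
  interpret comm_group "int_vectors G" by (rule comm_group_int_vectors)
  interpret group_hom "int_vectors G" "int_vectors G" "laplacian_map G"
    by unfold_locales (rule laplacian_map_hom)
  show ?thesis
    by (intro subgroup_imp_normal img_is_subgroup)
qed

lemma comm_group_laplacian_coker: "comm_group (laplacian_coker G)"
  unfolding laplacian_coker_def
  by (intro comm_group.abelian_FactGroup comm_group_int_vectors
      normal_imp_subgroup laplacian_image_normal)

lemma (in comm_group) subgroup_torsion_elements: "subgroup (torsion_elements G) G"
proof (rule subgroupI)
  have "\<one> \<in> torsion_elements G"
    unfolding torsion_elements_def by (auto intro!: exI[of _ 1])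
  then show "torsion_elements G \<noteq> {}" by blast
  show "inv a \<in> torsion_elements G" if "a \<in> torsion_elements G" for a
    using that unfolding torsion_elements_def by (auto simp: nat_pow_inv)
  show "a \<otimes> b \<in> torsion_elements G"
    if ab: "a \<in> torsion_elements G" "b \<in> torsion_elements G" for a b
  proof -
    obtain k l :: nat where kl: "k > 0" "a [^] k = \<one>" "l > 0" "b [^] l = \<one>"
      and c: "a \<in> carrier G" "b \<in> carrier G"
      using ab unfolding torsion_elements_def by blast
    have "(a \<otimes> b) [^] (k * l) = (a [^] k) [^] l \<otimes> (b [^] l) [^] k"
      using c by (simp add: nat_pow_distrib nat_pow_pow mult.commute)
    also have "\<dots> = \<one>" using kl by simp
    finally show ?thesis
      using kl c unfolding torsion_elements_def by (auto intro!: exI[of _ "k * l"])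
  qed
qed (auto simp: torsion_elements_def)

lemma comm_group_Jac: "comm_group (Jac G)"
proof -
  interpret comm_group "laplacian_coker G" by (rule comm_group_laplacian_coker)
  have "subgroup (torsion_elements (laplacian_coker G)) (laplacian_coker G)"
    by (rule subgroup_torsion_elements)
  then show ?thesis
    unfolding Jac_def
    by (intro group.group_comm_groupI subgroup_imp_group)
      (auto simp: m_comm subgroup.mem_carrier)
qed



section \<open>The graph $\Delta(n;1,1,1)$\<close>

text \<open>
  The vertex $v_{x,y}$ is the pair \<open>(x, y)\<close>; the second index is the representative
  in \<open>{0..<n}\<close> of a residue class modulo \<open>n\<close>.
\<close>

definition Delta111 :: "nat \<Rightarrow> (nat \<times> int) pair_pre_digraph" where
  "Delta111 n =
     (let V = {1, 2, 3} \<times> {0..<int n} in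
      \<lparr>pverts = V,
       parcs = {((x, y), (x', y')). (x, y) \<in> V \<and> (x', y') \<in> V \<and>
                  (x = x' \<and> ([y' = y + 1] (mod int n) \<or> [y' = y - 1] (mod int n)) \<or>
                   y = y' \<and> x \<noteq> x')}\<rparr>)"

lemma pair_graph_Delta111:
  assumes "n \<ge> 3"
  shows "pair_graph (Delta111 n)"
proof -
  have sub: "parcs (Delta111 n) \<subseteq> pverts (Delta111 n) \<times> pverts (Delta111 n)"
    by (auto simp: Delta111_def Let_def)
  have fin: "finite (pverts (Delta111 n))"
    by (simp add: Delta111_def)
  have noloop: "\<not> [y = y + 1] (mod int n)" "\<not> [y = y - 1] (mod int n)" for y :: int
    using assms by (auto simp: cong_iff_dvd_diff dest: zdvd_imp_le)
  have flip: "[y' = y + 1] (mod int n) \<longleftrightarrow> [y = y' - 1] (mod int n)" for y y' :: int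
    by (simp add: cong_iff_dvd_diff) (metis dvd_diff_commute diff_diff_eq2 add.commute diff_diff_eq)
  have symm: "sym (parcs (Delta111 n))"
    unfolding sym_def by (auto simp: Delta111_def Let_def flip)
  show ?thesis
  proof
    show "finite (parcs (Delta111 n))"
      using sub fin by (meson finite_SigmaI finite_subset)
    show "symmetric (with_proj (Delta111 n))"
      using symm by (simp add: symmetric_def)
    show "fst e \<noteq> snd e" if "e \<in> parcs (Delta111 n)" for e
      using that noloop by (auto simp: Delta111_def Let_def)
  qed (use sub fin in auto)
qed

lemma connected_Delta111:
  assumes "n \<ge> 3"
  shows "Digraph_Component.connected (with_proj (Delta111 n))"
proof -
  let ?D = "Delta111 n"
  interpret pair_graph ?D by (rule pair_graph_Delta111[OF assms])
  have V: "pverts ?D = {1, 2, 3} \<times> {0..<int n}"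
    by (simp add: Delta111_def)
  have up: "(x, 0) \<rightarrow>\<^sup>*\<^bsub>?D\<^esub> (x, int k)" if "k < n" "x \<in> {1, 2, 3}" for x k
    using that(1)
  proof (induction k)
    case 0
    then show ?case using that(2) by (auto simp: V intro: reachable_refl)
  next
    case (Suc k)
    have "((x, int k), (x, int (Suc k))) \<in> parcs ?D"
      using Suc.prems that(2) by (auto simp: Delta111_def Let_def add.commute)
    then show ?case using reachable_adj_trans[OF Suc.IH[OF Suc_lessD[OF Suc.prems]]] by simp
  qed
  have from0: "(1, 0) \<rightarrow>\<^sup>*\<^bsub>?D\<^esub> v" if v: "v \<in> pverts ?D" for v
  proof -
    obtain x y where xy: "v = (x, y)" "x \<in> {1, 2, 3}" "0 \<le> y" "y < int n"
      using v by (auto simp: V)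
    have "(1, 0) \<rightarrow>\<^sup>*\<^bsub>?D\<^esub> (x, 0 :: int)"
    proof (cases "x = 1")
      case True
      then show ?thesis using assms by (auto simp: V intro: reachable_refl)
    next
      case False
      then have "((1, 0), (x, 0 :: int)) \<in> parcs ?D"
        using assms xy(2) by (auto simp: Delta111_def Let_def)
      then show ?thesis by (rule reachable_adjI)
    qed
    moreover have "(x, 0) \<rightarrow>\<^sup>*\<^bsub>?D\<^esub> v"
      using up[of "nat y" x] xy by auto
    ultimately show ?thesis by (rule reachable_trans)
  qed
  have "u \<rightarrow>\<^sup>*\<^bsub>?D\<^esub> v" if "u \<in> pverts ?D" "v \<in> pverts ?D" for u v
    using symmetric_reachable[OF sym_arcs from0[OF that(1)]] from0[OF that(2)]
    by (rule reachable_trans)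
  then have "strongly_connected (with_proj ?D)"
    using assms by (auto simp: strongly_connected_def V)
  then show ?thesis
    by (simp add: connected_def strongly_connected_def reachable_mk_symmetric_eq[OF sym_arcs])
qed


section \<open>The numbers $\nu(n)$\<close>

text \<open>
  $U_s(x)$ with a real index \<open>s\<close> and a complex argument. At $x = 5/2$ the value of
  \<^const>\<open>Arccos\<close> is purely imaginary; lemma \<open>chebyshev_U_five_halves\<close> below
  gives the resulting closed form, also for half-integer index.
\<close>

definition chebyshev_U :: "real \<Rightarrow> complex \<Rightarrow> complex" where
  "chebyshev_U s x = sin (of_real (s + 1) * Arccos x) / sin (Arccos x)"

text \<open>
  Taking \<open>Re\<close>, floor and \<open>nat\<close> loses nothing: the number is a natural number already,
  see lemma \<open>of_nat_nu\<close>.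
\<close>

definition nu :: "nat \<Rightarrow> nat" where
  "nu n = nat \<lfloor>Re (if odd n then of_real (sqrt 7) * chebyshev_U (real n / 2 - 1) (5/2)
                    else chebyshev_U (real n / 2 - 1) (5/2))\<rfloor>"

definition mu :: "nat \<Rightarrow> nat" where
  "mu n = (if odd n then 1 else 7)"

definition mu_hat :: "nat \<Rightarrow> nat" where
  "mu_hat n = gcd n 3 * mu n"

lemma chebyshev_U_five_halves:
  fixes m :: real
  defines "t \<equiv> (5 + sqrt 21) / 2"
  shows "chebyshev_U (m - 1) (5/2) = of_real ((t powr m - t powr (-m)) / (t - 1 / t))"
proof -
  have s21: "sqrt 21 * sqrt 21 = 21" "0 < sqrt 21"
    by simp_all
  have t0: "t > 0"
    unfolding t_def using s21(2) by (simp only: zero_less_divide_iff) linarith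
  have tinv: "1 / t = (5 - sqrt 21) / 2"
  proof -
    have "t * ((5 - sqrt 21) / 2) = 1"
      unfolding t_def using s21(1) by (simp add: algebra_simps)
    then show ?thesis
      using t0 by (metis less_irrefl nonzero_mult_div_cancel_left)
  qed
  have "csqrt (1 - (5/2)\<^sup>2) = csqrt (of_real (- (21/4)))"
    by (simp add: power2_eq_square)
  also have "\<dots> = \<i> * sqrt (21/4)"
    by (subst csqrt_of_real_nonpos) auto
  also have "sqrt (21/4) = sqrt 21 / 2"
    by (simp add: real_sqrt_divide)
  finally have cs: "csqrt (1 - (5/2)\<^sup>2) = \<i> * of_real (sqrt 21 / 2)" .
  have "5/2 + \<i> * csqrt (1 - (5/2)\<^sup>2) = of_real (1 / t)"
    unfolding cs tinv by (simp add: complex_eq_iff)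
  then have arc: "Arccos (5/2) = \<i> * of_real (ln t)"
    using t0 unfolding Arccos_def by (simp add: Ln_of_real ln_div del: of_real_divide)
  have sn: "sin (of_real a * Arccos (5/2)) = (of_real (t powr (-a)) - of_real (t powr a)) / (2 * \<i>)" for a :: real
  proof -
    have e: "exp (\<i> * (of_real a * (\<i> * of_real (ln t)))) = of_real (t powr (-a))"
      "exp (- (\<i> * (of_real a * (\<i> * of_real (ln t))))) = of_real (t powr a)"
      using t0 by (simp_all add: powr_def exp_of_real[symmetric] algebra_simps)
    show ?thesis
      unfolding arc sin_exp_eq e by simp
  qed
  have "sin (of_real 1 * Arccos (5/2)) = (of_real (1 / t) - of_real t) / (2 * \<i>)"
    unfolding sn using t0 by (simp add: powr_minus_divide)
  then have "chebyshev_U (m - 1) (5/2) =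
      ((of_real (t powr (-m)) - of_real (t powr m)) / (2 * \<i>)) / ((of_real (1 / t) - of_real t) / (2 * \<i>))"
    unfolding chebyshev_U_def using sn[of m] by simp
  also have "\<dots> = (of_real (t powr m) - of_real (t powr (-m))) / (of_real t - of_real (1 / t))"
  proof -
    have "(a / (2 * \<i>)) / (b / (2 * \<i>)) = (- a) / (- b)" for a b :: complex
      by simp
    then show ?thesis by (simp only: minus_diff_eq)
  qed
  finally show ?thesis
    by simp
qed

context
begin

private definition "s1 = (sqrt 7 + sqrt 3) / (2::real)"
private definition "s2 = (sqrt 7 - sqrt 3) / (2::real)"
private definition "r n = (if odd n then sqrt 7 else 1) * (s1 ^ n - s2 ^ n) / sqrt (21::real)"

private lemma s1_pos: "s1 > 0"
  unfolding s1_def by (simp add: add_pos_pos)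

private lemma s1_s2: "s1 * s2 = 1"
proof -
  have "s1 * s2 = ((sqrt 7)\<^sup>2 - (sqrt 3)\<^sup>2) / 4"
    unfolding s1_def s2_def by (simp add: power2_eq_square algebra_simps)
  then show ?thesis by simp
qed

private lemma sqrt_7_3: "sqrt 7 * sqrt 3 = sqrt (21::real)"
  by (simp flip: real_sqrt_mult)

private lemma s1_sq: "s1\<^sup>2 = (5 + sqrt 21) / 2"
  unfolding s1_def by (simp add: power2_sum power_divide flip: sqrt_7_3)

private lemma s2_sq: "s2\<^sup>2 = (5 - sqrt 21) / 2"
  unfolding s2_def by (simp add: power2_diff power_divide flip: sqrt_7_3)

private lemma s1_rec: "s1 ^ (n + 4) = 5 * s1 ^ (n + 2) - s1 ^ n"
proof -
  have "s1\<^sup>2 * s1\<^sup>2 = 5 * s1\<^sup>2 - 1"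
    unfolding s1_sq by (simp add: field_simps)
  then have "s1 ^ n * (s1\<^sup>2 * s1\<^sup>2) = s1 ^ n * (5 * s1\<^sup>2 - 1)"
    by simp
  moreover have "s1 ^ (n + 4) = s1 ^ n * (s1\<^sup>2 * s1\<^sup>2)" "s1 ^ (n + 2) = s1 ^ n * s1\<^sup>2"
    by (simp_all only: flip: power_add) simp_all
  ultimately show ?thesis
    by (simp add: right_diff_distrib del: add_2_eq_Suc')
qed

private lemma s2_rec: "s2 ^ (n + 4) = 5 * s2 ^ (n + 2) - s2 ^ n"
proof -
  have "s2\<^sup>2 * s2\<^sup>2 = 5 * s2\<^sup>2 - 1"
    unfolding s2_sq by (simp add: field_simps)
  then have "s2 ^ n * (s2\<^sup>2 * s2\<^sup>2) = s2 ^ n * (5 * s2\<^sup>2 - 1)"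
    by simp
  moreover have "s2 ^ (n + 4) = s2 ^ n * (s2\<^sup>2 * s2\<^sup>2)" "s2 ^ (n + 2) = s2 ^ n * s2\<^sup>2"
    by (simp_all only: flip: power_add) simp_all
  ultimately show ?thesis
    by (simp add: right_diff_distrib del: add_2_eq_Suc')
qed

private lemma cheb_r:
  "(if odd n then of_real (sqrt 7) * chebyshev_U (real n / 2 - 1) (5/2)
    else chebyshev_U (real n / 2 - 1) (5/2)) = of_real (r n)"
proof -
  have s2': "s2 = 1 / s1"
    using s1_s2 s1_pos by (simp add: field_simps)
  have p: "(s1\<^sup>2) powr (real n / 2) = s1 ^ n"
    using s1_pos by (simp add: powr_powr powr_realpow flip: powr_numeral)
  have q: "(s1\<^sup>2) powr (- (real n / 2)) = s2 ^ n"
    unfolding powr_minus p s2' by (simp add: power_divide inverse_eq_divide)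
  have d: "s1\<^sup>2 - 1 / s1\<^sup>2 = sqrt 21"
  proof -
    have "1 / s1\<^sup>2 = s2\<^sup>2"
      unfolding s2' by (simp add: power_divide)
    then show ?thesis by (simp add: s1_sq s2_sq field_simps)
  qed
  show ?thesis
    using chebyshev_U_five_halves[of "real n / 2"] unfolding s1_sq[symmetric] p q d
    by (simp add: r_def)
qed

private lemma r_rec: "r (n + 4) = 5 * r (n + 2) - r n"
  unfolding r_def s1_rec s2_rec by (simp add: field_simps)

private lemma r_0: "r 0 = 0"
  by (simp add: r_def)

private lemma r_1: "r 1 = 1"
  by (simp add: r_def s1_def s2_def sqrt_7_3 diff_divide_distrib[symmetric])

private lemma r_2: "r 2 = 1"
  by (simp add: r_def s1_sq s2_sq diff_divide_distrib[symmetric])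

private lemma r_3: "r 3 = 6"
proof -
  have "s1 ^ 3 - s2 ^ 3 = s1 * s1\<^sup>2 - s2 * s2\<^sup>2"
    by (simp add: power2_eq_square power3_eq_cube)
  also have "\<dots> = (5 * sqrt 3 + sqrt 7 * sqrt 21) / 2"
    unfolding s1_sq s2_sq unfolding s1_def s2_def by (simp add: algebra_simps add_divide_distrib diff_divide_distrib)
  also have "sqrt 7 * sqrt 21 = 7 * sqrt (3::real)"
    by (simp flip: sqrt_7_3)
  finally have "s1 ^ 3 - s2 ^ 3 = 6 * sqrt 3"
    by simp
  then show ?thesis
    by (simp add: r_def flip: sqrt_7_3)
qed

private lemma r_nat: "\<exists>a b :: nat. a \<le> b \<and> r n = real a \<and> r (n + 2) = real b"
proof (induction n rule: less_induct)
  case (less n)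
  consider "n = 0" | "n = 1" | "n \<ge> 2" by linarith
  then show ?case
  proof cases
    case 1
    then show ?thesis using r_0 r_2 by (intro exI[of _ 0] exI[of _ 1]) (simp del: add_2_eq_Suc')
  next
    case 2
    then show ?thesis using r_1 r_3 by (intro exI[of _ 1] exI[of _ 6]) (simp add: numeral_3_eq_3)
  next
    case 3
    then obtain k where k: "n = k + 2" by (metis le_add_diff_inverse2)
    then obtain a b where ab: "a \<le> b" "r k = real a" "r (k + 2) = real b"
      using less.IH[of k] by auto
    have "r (k + 4) = real (5 * b - a)"
      unfolding r_rec using ab by (simp add: of_nat_diff)
    moreover have "b \<le> 5 * b - a" using ab by simp
    ultimately show ?thesis
      using ab unfolding k by (intro exI[of _ b] exI[of _ "5 * b - a"]) (simp add: add.assoc del: add_2_eq_Suc')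
  qed
qed

private lemma real_nu: "real (nu n) = r n"
proof -
  obtain a where a: "r n = real a" using r_nat by blast
  show ?thesis
    unfolding nu_def cheb_r a by simp
qed

lemma of_nat_nu:
  "of_nat (nu n) = (if odd n then of_real (sqrt 7) * chebyshev_U (real n / 2 - 1) (5/2)
                    else chebyshev_U (real n / 2 - 1) (5/2))"
  unfolding cheb_r real_nu[symmetric] by simp

lemma nu_0: "nu 0 = 0"
  using real_nu[of 0] r_0 by simp

lemma nu_1: "nu 1 = 1"
  using real_nu[of 1] r_1 by simp

lemma nu_2: "nu 2 = 1"
  using real_nu[of 2] r_2 by simp

lemma nu_3: "nu 3 = 6"
  using real_nu[of 3] r_3 by simp

lemma nu_rec: "nu (n + 4) + nu n = 5 * nu (n + 2)"
proof -
  have "real (nu (n + 4) + nu n) = real (5 * nu (n + 2))"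
    by (simp add: real_nu r_rec del: add_2_eq_Suc')
  then show ?thesis by (simp only: of_nat_eq_iff)
qed

end

text \<open>Hence the quotient of the two greatest common divisors in the theorem is exact.\<close>

lemma gcd_3_dvd_gcd_nu: "gcd n 3 dvd gcd n (nu n)"
proof -
  have step: "3 dvd nu (k + 6) \<longleftrightarrow> 3 dvd nu k" for k
  proof -
    have "nu (k + 6) + 5 * nu k = 24 * nu (k + 2)"
      using nu_rec[of k] nu_rec[of "k + 2"] by (simp add: add.assoc del: add_2_eq_Suc')
    then show ?thesis by presburger
  qed
  have mult3: "3 dvd nu (3 * k)" for k
  proof (induction k rule: less_induct)
    case (less k)
    consider "k = 0" | "k = 1" | "k \<ge> 2" by linarith
    then show ?case
    proof cases
      case 3
      then obtain j where "k = j + 2" by (metis le_add_diff_inverse2)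
      then show ?thesis using less.IH[of j] step[of "3 * j"] by (simp add: add.commute)
    qed (simp_all add: nu_0 nu_3)
  qed
  show ?thesis
  proof (cases "3 dvd n")
    case True
    then show ?thesis using mult3[of "n div 3"] by (simp add: gcd_dvdI2)
  next
    case False
    moreover have "prime (3 :: nat)"
      by simp
    ultimately have "coprime n 3"
      by (metis coprime_commute prime_imp_coprime)
    then show ?thesis by simp
  qed
qed

end

theory Submission
  imports
    Defs
    "HOL-Computational_Algebra.Polynomial"
begin

text \<open>
  Encode an integer vector by three polynomials in \<open>T\<close>, one for each value of the first index; shifting
  the second index is multiplication by \<open>T\<close> modulo \<open>T\<^sup>n - 1\<close>. With the generators \<open>v\<^sub>1\<close> and
  \<open>u = v\<^sub>2 - v\<^sub>1\<close> the relations of the cokernel become \<open>Q u = 0\<close> and \<open>(T - 1)\<^sup>2 Q v\<^sub>1 = 0\<close> with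
  \<open>Q = T\<^sup>2 - 5 T + 1\<close>, so the cokernel is
  \<open>\<int>[T] / (Q, T\<^sup>n - 1) \<oplus> \<int>[T] / ((T - 1)\<^sup>2 Q, T\<^sup>n - 1)\<close>.
  Modulo \<open>(T - 1) Q\<close> the polynomial \<open>1 + T + \<dots> + T\<^bsup>n-1\<^esup>\<close> is, up to a power of the unit \<open>T\<close>, equal to
  \<open>\<kappa> (\<nu>(n) - c Q)\<close>, where \<open>\<kappa> = 1\<close> and \<open>n = \<nu>(n) + 3 c\<close> for odd \<open>n\<close>, and \<open>\<kappa> = 1 + T\<close> and
  \<open>n = 2 (\<nu>(n) + 3 c)\<close> for even \<open>n\<close>. This reduces both summands to small explicit integer lattices.
  Their diagonal forms only need that 3-adically \<open>\<nu>(n)\<close> is \<open>2 n\<close> (\<open>n\<close> odd) or \<open>n\<close> (\<open>n\<close> even) to leading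
  order when \<open>3\<close> divides \<open>n\<close>, and that \<open>\<nu>(n)\<close> is divisible by the power of \<open>7\<close> in \<open>n\<close> when \<open>n\<close> is even.
\<close>

section \<open>Torsion of quotients and cyclic groups\<close>

lemma is_iso_torsion_elements:
  assumes "group A" "group B" "A \<cong> B"
  shows "A\<lparr>carrier := torsion_elements A\<rparr> \<cong> B\<lparr>carrier := torsion_elements B\<rparr>"
proof -
  obtain f where f: "f \<in> iso A B" using assms(3) by (auto simp: is_iso_def)
  interpret group_hom A B f
    using assms f by (simp add: group_hom_def group_hom_axioms_def iso_imp_homomorphism)
  have inj: "inj_on f (carrier A)" and surj: "f ` carrier A = carrier B"
    using f by (auto simp: iso_def bij_betw_def)
  have img: "f ` torsion_elements A = torsion_elements B"
  proof (intro subset_antisym subsetI)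
    fix y assume "y \<in> torsion_elements B"
    then obtain k :: nat where k: "y \<in> carrier B" "k > 0" "y [^]\<^bsub>B\<^esub> k = \<one>\<^bsub>B\<^esub>"
      by (auto simp: torsion_elements_def)
    obtain x where x: "x \<in> carrier A" "y = f x" using k(1) surj by auto
    have "f (x [^]\<^bsub>A\<^esub> k) = f \<one>\<^bsub>A\<^esub>"
      using k x by (simp add: hom_nat_pow)
    then have "x [^]\<^bsub>A\<^esub> k = \<one>\<^bsub>A\<^esub>"
      by (rule inj_onD[OF inj]) (use x in auto)
    then show "y \<in> f ` torsion_elements A"
      using x k(2) by (auto simp: torsion_elements_def)
  next
    fix y assume "y \<in> f ` torsion_elements A"
    then obtain x and k :: nat where "x \<in> carrier A" "y = f x" "k > 0" "x [^]\<^bsub>A\<^esub> k = \<one>\<^bsub>A\<^esub>"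
      by (auto simp: torsion_elements_def)
    then show "y \<in> torsion_elements B"
      using hom_nat_pow[of x k] by (auto simp: torsion_elements_def intro!: exI[of _ k])
  qed
  have sub: "torsion_elements A \<subseteq> carrier A"
    by (auto simp: torsion_elements_def)
  have "bij_betw f (torsion_elements A) (torsion_elements B)"
    using inj img inj_on_subset sub by (auto simp: bij_betw_def)
  moreover have "f \<in> hom (A\<lparr>carrier := torsion_elements A\<rparr>) (B\<lparr>carrier := torsion_elements B\<rparr>)"
    using img sub by (auto simp: hom_def subset_iff)
  ultimately show ?thesis
    by (auto simp: is_iso_def iso_def)
qed

lemma DirProd_nat_pow:
  "(x, y) [^]\<^bsub>A \<times>\<times> B\<^esub> (k :: nat) = (x [^]\<^bsub>A\<^esub> k, y [^]\<^bsub>B\<^esub> k)"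
  by (induction k) simp_all

text \<open>A group of exponent \<open>e\<close> is all torsion and 0 is the only torsion integer,
  so \<open>fst\<close> maps the torsion part bijectively onto \<open>H\<close>.\<close>

lemma torsion_DirProd_integer_group:
  assumes "group H" and e: "e > 0" "\<And>h. h \<in> carrier H \<Longrightarrow> h [^]\<^bsub>H\<^esub> (e :: nat) = \<one>\<^bsub>H\<^esub>"
  shows "(H \<times>\<times> integer_group)\<lparr>carrier := torsion_elements (H \<times>\<times> integer_group)\<rparr> \<cong> H"
proof -
  interpret H: group H by fact
  have pow: "k [^]\<^bsub>integer_group\<^esub> m = int m * k" for k and m :: nat
    by (induction m) (simp_all add: distrib_right)
  have tor: "torsion_elements (H \<times>\<times> integer_group) = carrier H \<times> {0}"
    using e by (auto simp: torsion_elements_def DirProd_nat_pow pow intro!: exI[of _ e])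
  have "fst \<in> iso ((H \<times>\<times> integer_group)\<lparr>carrier := carrier H \<times> {0}\<rparr>) H"
    by (auto simp: iso_def hom_def bij_betw_def inj_on_def image_iff)
  then show ?thesis
    unfolding tor is_iso_def by blast
qed

text \<open>This is the form in which the Jacobian group is computed: \<open>psi\<close> and
  \<open>delta\<close> together map onto \<open>H\<close> times the integers with common kernel
  \<open>K\<close>, and passing to torsion removes the coordinate \<open>delta\<close>.\<close>

lemma torsion_FactGroup_iso:
  assumes G: "group G" and H: "group H" "e > 0" "\<And>h. h \<in> carrier H \<Longrightarrow> h [^]\<^bsub>H\<^esub> (e :: nat) = \<one>\<^bsub>H\<^esub>"
    and psi: "psi \<in> hom G H" and delta: "delta \<in> hom G integer_group"
    and K: "K = {z \<in> carrier G. psi z = \<one>\<^bsub>H\<^esub> \<and> delta z = 0}"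
    and surj: "\<And>h k. h \<in> carrier H \<Longrightarrow> \<exists>z\<in>carrier G. psi z = h \<and> delta z = k"
  shows "(G Mod K)\<lparr>carrier := torsion_elements (G Mod K)\<rparr> \<cong> H"
proof -
  let ?P = "H \<times>\<times> integer_group"
  have P: "group ?P" using H by (simp add: DirProd_group)
  interpret group_hom G ?P "\<lambda>z. (psi z, delta z)"
    using G P psi delta by (auto simp: group_hom_def group_hom_axioms_def hom_def)
  have ker: "kernel G ?P (\<lambda>z. (psi z, delta z)) = K"
    by (auto simp: kernel_def K)
  have "(\<lambda>z. (psi z, delta z)) ` carrier G = carrier ?P"
  proof (intro subset_antisym subsetI)
    fix p assume "p \<in> carrier ?P"
    then obtain z where "z \<in> carrier G" "psi z = fst p" "delta z = snd p"
      using surj[of "fst p" "snd p"] by auto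
    then show "p \<in> (\<lambda>z. (psi z, delta z)) ` carrier G"
      by (auto intro!: image_eqI[of _ _ z])
  qed (use psi in \<open>auto simp: hom_def\<close>)
  then have iso: "G Mod K \<cong> ?P"
    using FactGroup_iso ker by simp
  have "group (G Mod K)"
    using normal.factorgroup_is_group[OF normal_kernel] ker by simp
  from is_iso_torsion_elements[OF this P iso] show ?thesis
    using torsion_DirProd_integer_group[OF H] iso_trans by blast
qed

text \<open>Chinese remainder theorem. Coprimality makes the pair of reductions injective, and equal
  cardinalities make it bijective.\<close>

lemma integer_mod_group_mult_iso:
  assumes "coprime a b" and pos: "a > 0" "b > 0"
  shows "integer_mod_group (a * b) \<cong> integer_mod_group a \<times>\<times> integer_mod_group b"
proof -
  have "bij_betw (\<lambda>x. (x mod int a, x mod int b)) {0..<int a * int b} ({0..<int a} \<times> {0..<int b})"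
  proof -
    have "inj_on (\<lambda>x. (x mod int a, x mod int b)) {0..<int a * int b}"
    proof (rule inj_onI)
      fix x y assume xy: "x \<in> {0..<int a * int b}" "y \<in> {0..<int a * int b}"
        "(x mod int a, x mod int b) = (y mod int a, y mod int b)"
      then have "[x = y] (mod int a)" "[x = y] (mod int b)"
        by (auto simp: cong_def)
      then have "[x = y] (mod int a * int b)"
        using assms by (intro coprime_cong_mult) auto
      then show "x = y" using xy by (auto simp: cong_def)
    qed
    moreover have "(\<lambda>x. (x mod int a, x mod int b)) ` {0..<int a * int b} \<subseteq> {0..<int a} \<times> {0..<int b}"
      using pos by auto
    ultimately show ?thesis
      unfolding bij_betw_def by (simp add: card_subset_eq card_image card_cartesian_product nat_mult_distrib)
  qed
  then show ?thesis
    using pos unfolding is_iso_def iso_def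
    by (auto simp: carrier_integer_mod_group hom_def mod_add_eq mod_mod_cancel
        intro!: exI[of _ "\<lambda>x. (x mod int a, x mod int b)"])
qed

lemma DirProd_rotate_iso: "(A \<times>\<times> B) \<times>\<times> C \<cong> B \<times>\<times> A \<times>\<times> C"
proof -
  have "(\<lambda>((x, y), z). (y, x, z)) \<in> iso ((A \<times>\<times> B) \<times>\<times> C) (B \<times>\<times> A \<times>\<times> C)"
    by (auto simp: iso_def hom_def inj_on_def bij_betw_def image_iff)
  then show ?thesis by (auto simp: is_iso_def)
qed

section \<open>Divisibility properties of $\nu(n)$\<close>

lemma real_nu_powr:
  defines "t \<equiv> (5 + sqrt 21) / 2"
  shows "real (nu n) = (if odd n then sqrt 7 else 1) * (t powr (n / 2) - 1 / t powr (n / 2)) / sqrt 21"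
proof -
  have t: "t > 0"
    by (simp add: t_def add_pos_pos)
  have "t * ((5 - sqrt 21) / 2) = 1"
    by (simp add: t_def algebra_simps)
  then have "1 / t = (5 - sqrt 21) / 2"
    using t by (metis less_irrefl nonzero_mult_div_cancel_left)
  then have d: "t - 1 / t = sqrt 21"
    by (simp add: t_def field_simps)
  have "complex_of_real (real (nu n)) =
      of_real ((if odd n then sqrt 7 else 1) * (t powr (n / 2) - 1 / t powr (n / 2)) / sqrt 21)"
    using of_nat_nu[of n] chebyshev_U_five_halves[of "n / 2"] d
    by (simp add: t_def[symmetric] powr_minus_divide)
  then show ?thesis
    by (simp only: of_real_eq_iff)
qed

lemma nu_pos: "n > 0 \<Longrightarrow> nu n > 0"
proof -
  assume n: "n > 0"
  have "(5 + sqrt 21) / 2 > (1::real)"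
    using real_sqrt_gt_zero[of 21] by (simp add: add_pos_pos)
  then have "((5 + sqrt 21) / 2) powr (n / 2) > (1::real)"
    using n by (intro gr_one_powr) auto
  then have "((5 + sqrt 21) / 2) powr (n / 2) - 1 / ((5 + sqrt 21) / 2) powr (n / 2) > (0::real)"
    by (smt (verit) divide_less_eq_1)
  then have "real (nu n) > 0"
    unfolding real_nu_powr by (intro divide_pos_pos mult_pos_pos) auto
  then show ?thesis by simp
qed

text \<open>With \<open>a = t powr (n / 2)\<close> the number \<open>\<nu>(k n)\<close> is a multiple of \<open>a ^ k - a powi (- k)\<close>,
  which factors through \<open>(a - 1 / a)\<^sup>2 = 3 \<mu>(n) \<nu>(n)\<^sup>2\<close>.\<close>

lemma nu_multiple_aux:
  assumes "n > 0"
  obtains a :: real where "a > 0" "a - 1 / a \<noteq> 0"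
    "(a - 1 / a)\<^sup>2 = real (3 * mu n * (nu n)\<^sup>2)"
    "\<And>k. odd k \<or> even n \<Longrightarrow> real (nu (k * n)) * (a - 1 / a) = real (nu n) * (a ^ k - 1 / a ^ k)"
proof -
  let ?t = "(5 + sqrt 21) / 2 :: real" and ?c = "if odd n then sqrt 7 else 1 :: real"
  have t: "?t > 0"
    by (simp add: add_pos_pos)
  define a where "a = ?t powr (n / 2)"
  have a: "a > 0"
    using t by (simp add: a_def)
  have nu1: "real (nu n) * sqrt 21 = ?c * (a - 1 / a)"
    using real_nu_powr[of n] by (simp add: a_def)
  have "(real (nu n)) ^ 2 * 21 = ?c ^ 2 * (a - 1 / a) ^ 2"
    using arg_cong[OF nu1, of "\<lambda>x. x\<^sup>2"] by (simp only: power_mult_distrib) simp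
  then have 1: "(a - 1 / a)\<^sup>2 = real (3 * mu n * (nu n)\<^sup>2)"
    by (auto simp: mu_def split: if_splits)
  have "real (nu (k * n)) * (a - 1 / a) = real (nu n) * (a ^ k - 1 / a ^ k)"
    if "odd k \<or> even n" for k
  proof -
    have "?t powr ((k * n) / 2) = a ^ k"
      using t by (simp add: a_def powr_powr mult.commute flip: powr_realpow)
    \<comment> \<open>The condition on \<open>k\<close> and \<open>n\<close> gives
      \<open>k * n\<close> the parity of \<open>n\<close>, so the same factor \<open>?c\<close>
      belongs to both indices.\<close>
    then have "real (nu (k * n)) * sqrt 21 = ?c * (a ^ k - 1 / a ^ k)"
      using real_nu_powr[of "k * n"] that by auto
    then have "(real (nu (k * n)) * (a - 1 / a)) * sqrt 21 = (real (nu n) * (a ^ k - 1 / a ^ k)) * sqrt 21"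
    proof -
      have "y * p * s = x * q * s" if "y * s = c * q" "x * s = c * p" for x y p q s c :: real
        using that by algebra
      then show ?thesis using nu1 \<open>real (nu (k * n)) * sqrt 21 = _\<close> by blast
    qed
    then show ?thesis by simp
  qed
  moreover have "a - 1 / a \<noteq> 0"
  proof
    assume "a - 1 / a = 0"
    then have "3 * mu n * (nu n)\<^sup>2 = 0"
      using 1 by (metis of_nat_eq_0_iff zero_power2)
    then show False
      using nu_pos[OF assms] by (auto simp: mu_def split: if_splits)
  qed
  ultimately show ?thesis using that a 1 by blast
qed

text \<open>The cofactor of \<open>a - 1 / a\<close> in \<open>a ^ 3 - 1 / a ^ 3\<close> is
  \<open>(a - 1 / a)\<^sup>2 + 3\<close>, and the square is
  \<open>3 * mu n * (nu n)\<^sup>2\<close>, so both summands carry a factor 3.\<close>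

lemma nu_triple: "nu (3 * n) = 3 * nu n * (mu n * (nu n)\<^sup>2 + 1)"
proof (cases "n = 0")
  case False
  obtain a :: real where a: "a > 0" "(a - 1 / a)\<^sup>2 = real (3 * mu n * (nu n)\<^sup>2)"
    "\<And>k. odd k \<or> even n \<Longrightarrow> real (nu (k * n)) * (a - 1 / a) = real (nu n) * (a ^ k - 1 / a ^ k)"
    and nz: "a - 1 / a \<noteq> 0"
    using nu_multiple_aux[of n] False by blast
  have "a ^ 3 - 1 / a ^ 3 = (a - 1 / a) * ((a - 1 / a)\<^sup>2 + 3)"
    using a(1) by (simp add: field_simps power2_eq_square power3_eq_cube)
  then have "real (nu (3 * n)) * (a - 1 / a) = real (nu n) * ((a - 1 / a)\<^sup>2 + 3) * (a - 1 / a)"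
    using a(3)[of 3] by simp
  then have "real (nu (3 * n)) = real (nu n) * ((a - 1 / a)\<^sup>2 + 3)"
    using nz by simp
  also have "\<dots> = real (3 * nu n * (mu n * (nu n)\<^sup>2 + 1))"
    unfolding a(2) by (simp add: algebra_simps)
  finally show ?thesis by (simp only: of_nat_eq_iff)
qed (simp add: nu_0)

text \<open>With \<open>a * b = 1\<close>, the cofactor of \<open>a - b\<close> in
  \<open>a ^ 7 - b ^ 7\<close> is a polynomial in \<open>(a - b)\<^sup>2\<close>. For even
  \<open>n\<close> this square is \<open>21 * (nu n)\<^sup>2\<close>, so 7 divides every term of the
  cofactor.\<close>

lemma nu_septuple: "even n \<Longrightarrow> 7 * nu n dvd nu (7 * n)"
proof (cases "n = 0")
  case False
  assume "even n"
  obtain a :: real where a: "a > 0" "(a - 1 / a)\<^sup>2 = real (3 * mu n * (nu n)\<^sup>2)"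
    "\<And>k. odd k \<or> even n \<Longrightarrow> real (nu (k * n)) * (a - 1 / a) = real (nu n) * (a ^ k - 1 / a ^ k)"
    and nz: "a - 1 / a \<noteq> 0"
    using nu_multiple_aux[of n] False by blast
  define b where "b = 1 / a"
  have "a * b = 1" using a(1) by (simp add: b_def)
  then have "a ^ 7 - b ^ 7 = (a - b) * (((a - b)\<^sup>2)^3 + 7 * ((a - b)\<^sup>2)\<^sup>2 + 14 * (a - b)\<^sup>2 + 7)"
    by algebra
  then have "real (nu (7 * n)) * (a - b) =
      real (nu n) * (((a - b)\<^sup>2)^3 + 7 * ((a - b)\<^sup>2)\<^sup>2 + 14 * (a - b)\<^sup>2 + 7) * (a - b)"
    using a(3)[of 7] by (simp add: b_def power_one_over)
  then have "real (nu (7 * n)) = real (nu n) * (((a - b)\<^sup>2)^3 + 7 * ((a - b)\<^sup>2)\<^sup>2 + 14 * (a - b)\<^sup>2 + 7)"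
    using nz by (simp add: b_def)
  also have "\<dots> = real (nu n * ((21 * (nu n)\<^sup>2)^3 + 7 * (21 * (nu n)\<^sup>2)\<^sup>2 + 14 * (21 * (nu n)\<^sup>2) + 7))"
    using a(2) \<open>even n\<close> by (simp add: b_def mu_def)
  also have "nu n * ((21 * (nu n)\<^sup>2)^3 + 7 * (21 * (nu n)\<^sup>2)\<^sup>2 + 14 * (21 * (nu n)\<^sup>2) + 7) =
      7 * nu n * (1323 * (nu n)^6 + 441 * (nu n)^4 + 42 * (nu n)\<^sup>2 + 1)"
    by algebra
  finally have "nu (7 * n) = 7 * nu n * (1323 * (nu n)^6 + 441 * (nu n)^4 + 42 * (nu n)\<^sup>2 + 1)"
    by (simp only: of_nat_eq_iff)
  then show ?thesis by simp
qed (simp add: nu_0)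

text \<open>Modulo 3 the coefficient 5 of the recurrence for \<open>nu\<close> becomes 2, and
  \<open>s (n + 4) = 2 * s (n + 2) - s n\<close> also holds for \<open>s n = n\<close>. Hence four
  initial values suffice.\<close>

lemma nu_mod_3:
  "3 dvd int n - (if odd n then 1 else 2) * int (nu n)"
proof (induction n rule: less_induct)
  case (less n)
  consider "n = 0" | "n = 1" | "n = 2" | "n = 3" | "n \<ge> 4" by linarith
  then show ?case
  proof cases
    case 5
    then obtain k where k: "n = k + 4" by (metis le_add_diff_inverse2)
    show ?thesis
      using less.IH[of k] less.IH[of "k + 2"] nu_rec[of k] unfolding k
      by (auto simp del: add_2_eq_Suc' split: if_splits) presburger+
  qed (use nu_0 nu_1 nu_2 nu_3 in \<open>simp_all\<close>)
qed

text \<open>Each tripling multiplies \<open>nu\<close> by 3 and by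
  \<open>mu * nu\<^sup>2 + 1\<close>. At the first one \<open>nu j\<close> is prime to 3, the
  cofactor is 2 modulo 3, and the minus sign of \<open>nu_mod_3\<close> becomes a plus. From then on
  3 divides \<open>nu\<close>, the cofactor is 1 modulo 3, and the relation persists.\<close>

lemma nu_3_power:
  assumes "\<not> 3 dvd j"
  shows "\<exists>u. nu (3 ^ Suc k * j) = 3 ^ Suc k * u \<and> 3 dvd int j + (if odd j then 1 else 2) * int u"
proof (induction k)
  case 0
  define M :: int where "M = (if odd j then 1 else 2)"
  define v where "v = int (nu j)"
  have "3 dvd int j - M * v"
    using nu_mod_3[of j] by (simp add: M_def v_def)
  have j3: "int j mod 3 \<noteq> 0"
    using assms by presburger
  have "3 dvd int j + M * (v * (int (mu j) * v\<^sup>2 + 1))"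
  proof -
    have "v mod 3 = 1 \<or> v mod 3 = 2"
      using \<open>3 dvd int j - M * v\<close> j3 by (auto simp: M_def split: if_splits) presburger+
    then have "v\<^sup>2 mod 3 = 1"
      by (auto simp: power2_eq_square mod_mult_eq[symmetric, of v v])
    then have "(int (mu j) * v\<^sup>2 + 1) mod 3 = 2"
      by (auto simp: mu_def) presburger+
    then obtain q where "int (mu j) * v\<^sup>2 + 1 = 3 * q + 2"
      by (metis mult_div_mod_eq)
    then have "int j + M * (v * (int (mu j) * v\<^sup>2 + 1)) = (int j - M * v) + 3 * (M * v * (q + 1))"
      by (simp add: algebra_simps)
    then show ?thesis
      using \<open>3 dvd int j - M * v\<close> by (simp only: dvd_add dvd_triv_left)
  qed
  then show ?case
    using nu_triple[of j]
    by (intro exI[of _ "nu j * (mu j * (nu j)\<^sup>2 + 1)"]) (simp add: M_def v_def algebra_simps)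
next
  case (Suc k)
  then obtain u where u: "nu (3 ^ Suc k * j) = 3 ^ Suc k * u"
    "3 dvd int j + (if odd j then 1 else 2) * int u" by blast
  let ?N = "3 ^ Suc k * j"
  let ?w = "u * (mu ?N * (nu ?N)\<^sup>2 + 1)"
  have "int ?w = int u + 3 * (int u * int (mu ?N) * (3 * int (3 ^ k * u) ^ 2))"
    unfolding u(1) by (simp add: power2_eq_square algebra_simps)
  then obtain q where q: "int ?w = int u + 3 * q" by blast
  have "int j + (if odd j then 1 else 2) * int ?w =
    int j + (if odd j then 1 else 2) * int u + 3 * ((if odd j then 1 else 2) * q)"
    unfolding q by (simp add: algebra_simps)
  then have "3 dvd int j + (if odd j then 1 else 2) * int ?w"
    using u(2) by (metis dvd_add dvd_triv_left)
  moreover have "nu (3 ^ Suc (Suc k) * j) = 3 ^ Suc (Suc k) * ?w"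
  proof -
    have "nu (3 ^ Suc (Suc k) * j) = 3 * nu ?N * (mu ?N * (nu ?N)\<^sup>2 + 1)"
      using nu_triple[of ?N] by (simp add: mult.assoc)
    also have "3 * nu ?N = 3 ^ Suc (Suc k) * u"
      using u(1) by simp
    finally show ?thesis by (simp only: mult.assoc)
  qed
  ultimately show ?case by blast
qed

lemma nu_7_power: "even j \<Longrightarrow> 7 ^ k dvd nu (7 ^ k * j)"
proof (induction k)
  case (Suc k)
  then have "7 * 7 ^ k dvd 7 * nu (7 ^ k * j)"
    by simp
  also have "\<dots> dvd nu (7 * (7 ^ k * j))"
    using Suc.prems by (intro nu_septuple) simp
  finally show ?case by (simp add: mult.assoc)
qed simp

section \<open>Integer polynomials modulo $T^2 - 5T + 1$ and $(T - 1)^2 (T^2 - 5T + 1)$\<close>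

lemma monic_dvd_low_degree:
  fixes g r :: "int poly"
  assumes "g dvd r" "degree r < degree g"
  shows "r = 0"
  using assms by (metis dvd_imp_degree_le not_le)

text \<open>Pseudo-division scales the dividend by a power of the leading coefficient, which is 1
  here, so it is genuine division over the integers.\<close>

lemma monic_remainder:
  fixes f g :: "int poly"
  assumes "lead_coeff g = 1" "degree g > 0"
  obtains r where "g dvd f - r" "degree r < degree g"
proof -
  have "g \<noteq> 0" using assms by auto
  obtain q r where "pseudo_divmod f g = (q, r)" by fastforce
  from pseudo_divmod[OF \<open>g \<noteq> 0\<close> this] assms
  have "f = g * q + r" "degree r < degree g" by auto
  then show ?thesis using that[of r] by simp
qed

lemma poly_degree_less_2: "degree (r :: int poly) < 2 \<Longrightarrow> r = [:coeff r 0, coeff r 1:]"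
  by (rule poly_eqI) (auto simp: coeff_pCons coeff_eq_0 split: nat.splits)

lemma poly_degree_less_4:
  "degree (r :: int poly) < 4 \<Longrightarrow> r = [:coeff r 0, coeff r 1, coeff r 2, coeff r 3:]"
  by (rule poly_eqI) (auto simp: coeff_pCons coeff_eq_0 numeral_2_eq_2 numeral_3_eq_3 split: nat.splits)

abbreviation "X \<equiv> [:0, 1:: int:]"

definition Q :: "int poly" where "Q = X^2 - 5 * X + 1"

lemma Q_coeffs: "Q = [:1, -5, 1:]"
  by (simp add: Q_def power2_eq_square numeral_poly one_pCons)

lemma square_X_Q_coeffs: "(X - 1) * Q * (X - 1) = [:1, -7, 12, -7, 1:]"
  by (simp add: Q_coeffs one_pCons)

lemma linear_remainder: "\<exists>a b. Q dvd f - (of_int a + of_int b * X)"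
proof -
  obtain r where r: "Q dvd f - r" "degree r < degree Q"
    by (rule monic_remainder[of Q f]) (simp_all add: Q_coeffs)
  then have "degree r < 2" by (simp add: Q_coeffs)
  from poly_degree_less_2[OF this] have "r = of_int (coeff r 0) + of_int (coeff r 1) * X"
    by (simp add: of_int_poly)
  then show ?thesis using r(1) by metis
qed

lemma linear_unique:
  assumes "Q dvd of_int a + of_int b * X"
  shows "a = 0" "b = 0"
proof -
  have "of_int a + of_int b * X = [:a, b:]" by (simp add: of_int_poly)
  moreover have "degree [:a, b:] < degree Q" by (auto simp: Q_coeffs)
  ultimately show "a = 0" "b = 0" using monic_dvd_low_degree[of Q "[:a, b:]"] assms by auto
qed

text \<open>Remainders are written in the basis \<open>1\<close>, \<open>X - 1\<close>,
  \<open>(X - 1)^2\<close>, \<open>Q * (X - 1)\<close>. Then \<open>d\<close> is the value at 1 and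
  becomes the free coordinate of the cokernel; dividing the rest by \<open>X - 1\<close> leaves
  coordinates in the basis \<open>1\<close>, \<open>X - 1\<close>, \<open>Q\<close> modulo
  \<open>(X - 1) * Q\<close>.\<close>

abbreviation cubic :: "int \<Rightarrow> int \<Rightarrow> int \<Rightarrow> int \<Rightarrow> int poly" where
  "cubic d x y z \<equiv> of_int d + (of_int x + of_int y * (X - 1) + of_int z * Q) * (X - 1)"

lemma cubic_coeffs: "cubic d x y z = [:d - x + y - z, x - 2 * y + 6 * z, y - 6 * z, z:]"
  by (simp add: Q_coeffs of_int_poly one_pCons)

lemma cubic_remainder: "\<exists>d x y z. (X - 1) * Q * (X - 1) dvd f - cubic d x y z"
proof -
  obtain r where r: "(X - 1) * Q * (X - 1) dvd f - r" "degree r < degree ((X - 1) * Q * (X - 1))"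
    by (rule monic_remainder[of "(X - 1) * Q * (X - 1)" f]) (simp_all only: square_X_Q_coeffs, simp_all)
  then have "degree r < 4" by (simp only: square_X_Q_coeffs) simp
  from poly_degree_less_4[OF this]
  \<comment> \<open>The arguments solve the triangular system of \<open>cubic_coeffs\<close>,
    starting from the top coefficient.\<close>
  have "r = cubic (coeff r 0 + coeff r 1 + coeff r 2 + coeff r 3)
      (coeff r 1 + 2 * coeff r 2 + 6 * coeff r 3) (coeff r 2 + 6 * coeff r 3) (coeff r 3)"
    unfolding cubic_coeffs by simp
  then show ?thesis using r(1) by metis
qed

lemma cubic_unique:
  assumes "(X - 1) * Q * (X - 1) dvd cubic d x y z"
  shows "d = 0" "x = 0" "y = 0" "z = 0"
proof -
  have "degree (cubic d x y z) < degree ((X - 1) * Q * (X - 1))"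
    unfolding cubic_coeffs square_X_Q_coeffs by auto
  then have "cubic d x y z = 0" using monic_dvd_low_degree assms by blast
  then show "d = 0" "x = 0" "y = 0" "z = 0" unfolding cubic_coeffs by auto
qed

text \<open>Modulo \<open>Q\<close> one has \<open>1 + X^2 = 5 * X\<close>, so
  \<open>X^j * v j\<close> obeys the recurrence of \<open>F\<close>. At \<open>X = 1\<close>, where
  \<open>Q\<close> is -3, so does \<open>v j + 3 * c j\<close>. The correction
  \<open>c j * Q\<close> makes both congruences hold at once.\<close>

lemma two_step_congruence:
  fixes F :: "nat \<Rightarrow> int poly" and v c :: "nat \<Rightarrow> int"
  assumes F: "\<And>j. F (j + 2) = (1 + X^2) * F (j + 1) - X^2 * F j"
    and v: "\<And>j. v (j + 2) = 5 * v (j + 1) - v j"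
    and c: "\<And>j. c (j + 2) = 2 * c (j + 1) - c j - v (j + 1)"
    and base: "F 0 = of_int (v 0) - of_int (c 0) * Q"
      "F 1 = X * of_int (v 1) - of_int (c 1) * Q"
  shows "(X - 1) * Q dvd F j - (X^j * of_int (v j) - of_int (c j) * Q)"
proof (induction j rule: less_induct)
  case (less j)
  consider "j = 0" | "j = 1" | i where "j = i + 2"
    by (metis One_nat_def add_2_eq_Suc' less_2_cases less_imp_Suc_add not_less_eq old.nat.exhaust)
  then show ?case
  proof cases
    case 3
    define D where "D i = F i - (X^i * of_int (v i) - of_int (c i) * Q)" for i
    have "(X - 1) dvd X ^ (i + 1) - 1" by (simp only: power_diff_1_eq dvd_triv_left)
    then obtain e where e: "X ^ (i + 1) - 1 = (X - 1) * e" by blast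
    \<comment> \<open>The defect \<open>D\<close> obeys the recurrence of \<open>F\<close> up to a
      multiple of \<open>(X - 1) * Q\<close>. The quotient \<open>e\<close> enters because the
      recurrences of \<open>v\<close> and \<open>c\<close> leave \<open>Q * v (i + 1)\<close> once
      with the factor \<open>X ^ (i + 1)\<close> and once without.\<close>
    have "D (i + 2) = (1 + X^2) * D (i + 1) - X^2 * D i +
      (X - 1) * Q * (of_int (v (i + 1)) * e - of_int (c (i + 1)) * (X + 1) + of_int (c i) * (X + 1))"
    proof -
      have ring: "F2 - (x^2 * p * (5 * v1 - v0) - (2 * c1 - c0 - v1) * q) =
        (1 + x^2) * (F1 - (x * p * v1 - c1 * q)) - x^2 * (F0 - (p * v0 - c0 * q)) +
        (x - 1) * q * (v1 * e - c1 * (x + 1) + c0 * (x + 1))"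
        if "q = x^2 - 5 * x + 1" "x * p - 1 = (x - 1) * e" "F2 = (1 + x^2) * F1 - x^2 * F0"
        for F2 F1 F0 x p v1 v0 c1 c0 q e :: "int poly"
        using that by algebra
      have e': "X * X ^ i - 1 = (X - 1) * e" using e by simp
      show ?thesis
        using ring[OF Q_def e' F[of i], of "of_int (v (i + 1))" "of_int (v i)" "of_int (c (i + 1))" "of_int (c i)"]
        unfolding D_def v c by (simp only: of_int_diff of_int_mult of_int_numeral power_add power_one_right mult.commute[of "X ^ i"])
    qed
    moreover have "(X - 1) * Q dvd D (i + 1)" "(X - 1) * Q dvd D i"
      unfolding D_def by (rule less.IH, simp add: 3)+
    ultimately show ?thesis
      unfolding 3 D_def[symmetric] by (simp add: dvd_add dvd_diff)
  qed (use base in simp_all)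
qed

text \<open>Modulo \<open>P\<close> the element \<open>u\<close> is a unit with inverse
  \<open>u'\<close>, so \<open>\<Phi>\<close> and \<open>H\<close> generate the same ideal. The
  common factor \<open>M\<close> is 1 for the quadratic modulus and \<open>X - 1\<close> for the
  quartic one.\<close>

lemma ideal_times_unit:
  fixes P :: "'a :: idom"
  assumes "P dvd \<Phi> - u * H" "P dvd u * u' - 1"
  shows "(\<exists>A B. f = A * (P * M) + B * (\<Phi> * M)) \<longleftrightarrow> (\<exists>A B. f = A * (P * M) + B * (H * M))"
proof -
  obtain k l where kl: "\<Phi> = u * H + P * k" "u * u' = 1 + P * l"
    using assms by (metis dvd_def diff_add_cancel add.commute)
  have "A * (P * M) + B * (\<Phi> * M) = (A + B * k) * (P * M) + (B * u) * (H * M)" for A B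
    unfolding kl by (simp add: algebra_simps)
  moreover have "A * (P * M) + B * (H * M) = (A - B * l * H - B * u' * k) * (P * M) + (B * u') * (\<Phi> * M)" for A B
    using kl by algebra
  ultimately show ?thesis by metis
qed


text \<open>Since \<open>(X - 1) * Q\<close> has constant term -1, \<open>X\<close> is a unit modulo
  it, with inverse \<open>X^2 - 6 * X + 6\<close>.\<close>

lemma X_unit: "(X - 1) * Q dvd X ^ j * (X^2 - 6 * X + 6) ^ j - 1"
proof -
  have "X * (X^2 - 6 * X + 6) - 1 dvd (X * (X^2 - 6 * X + 6)) ^ j - 1"
    by (simp only: power_diff_1_eq dvd_triv_left)
  moreover have "X * (X^2 - 6 * X + 6) - 1 = (X - 1) * Q"
    unfolding Q_def by algebra
  ultimately show ?thesis by (simp only: power_mult_distrib)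
qed

definition kappa :: "nat \<Rightarrow> int poly" where
  "kappa n = (if odd n then 1 else 1 + X)"

text \<open>Sums of odd length obey the two-step recurrence with roots 1 and \<open>X^2\<close>. For
  even length, splitting off \<open>1 + X\<close> leaves the sum of the even powers, which obeys it
  too. Along indices of one parity \<open>nu\<close> supplies the sequence \<open>v\<close>.\<close>

lemma geometric_sum_nu:
  assumes "n > 0" "int n = (if odd n then 1 else 2) * (int (nu n) + 3 * c)"
  obtains j where "(X - 1) * Q dvd (\<Sum>i<n. X ^ i) - X ^ j * (kappa n * (of_int (int (nu n)) - of_int c * Q))"
proof -
  \<comment> \<open>Against the factor \<open>Q\<close>, powers of \<open>X\<close> count as 1; this
    lets \<open>X ^ j\<close> be pulled out of both terms of the congruence.\<close>
  have shift: "(X - 1) * Q dvd X ^ j * of_int c * Q - of_int c * Q" for j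
  proof -
    have "X - 1 dvd X ^ j - 1"
      by (simp only: power_diff_1_eq dvd_triv_left)
    then have "(X - 1) * Q dvd (X ^ j - 1) * (of_int c * Q)"
      by (metis dvd_mult mult.commute mult_dvd_mono dvd_refl)
    then show ?thesis by (simp add: algebra_simps)
  qed
  show ?thesis
  proof (cases "odd n")
    case True
    then obtain j where j: "n = 2 * j + 1" by (rule oddE)
    \<comment> \<open>The division is exact by \<open>nu_mod_3\<close>, so the recurrence for
      \<open>C\<close> follows from those of the odd numbers and of \<open>nu\<close>.\<close>
    define C where "C i = (int (2 * i + 1) - int (nu (2 * i + 1))) div 3" for i
    have C: "int (nu (2 * i + 1)) = int (2 * i + 1) - 3 * C i" for i
      using nu_mod_3[of "2 * i + 1"] by (simp add: C_def)
    have v: "int (nu (2 * (i + 2) + 1)) = 5 * int (nu (2 * (i + 1) + 1)) - int (nu (2 * i + 1))" for i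
      using arg_cong[OF nu_rec[of "2 * i + 1"], of int]
      by (simp add: algebra_simps numeral_eq_Suc)
    have S: "(\<Sum>k<2 * (i + 2) + 1. X ^ k) = (1 + X^2) * (\<Sum>k<2 * (i + 1) + 1. X ^ k) - X^2 * (\<Sum>k<2 * i + 1. X ^ k)" for i
    proof -
      have "(\<Sum>k<2 * (i + 1) + 1. X ^ k) = (\<Sum>k<2 * i + 1. X ^ k) + X ^ (2 * i + 1) + X ^ (2 * i + 2)"
        by simp
      moreover have "(\<Sum>k<2 * (i + 2) + 1. X ^ k) = (\<Sum>k<2 * (i + 1) + 1. X ^ k) + X^2 * X ^ (2 * i + 1) + X^2 * X ^ (2 * i + 2)"
        by (simp flip: power_add add: numeral_eq_Suc)
      moreover have "c = (1 + x) * b - x * a" if "b = a + p + q" "c = b + x * p + x * q" for a b c p q x :: "int poly"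
        using that by algebra
      ultimately show ?thesis by blast
    qed
    have "(X - 1) * Q dvd (\<Sum>k<2 * j + 1. X ^ k) - (X ^ j * of_int (int (nu (2 * j + 1))) - of_int (C j) * Q)"
    proof (rule two_step_congruence[where v = "\<lambda>j. int (nu (2 * j + 1))", OF S v])
      show "C (i + 2) = 2 * C (i + 1) - C i - int (nu (2 * (i + 1) + 1))" for i
        using v[of i] C[of i] C[of "i + 1"] C[of "i + 2"] by simp
      show "(\<Sum>k<2 * 0 + 1. X ^ k) = of_int (int (nu (2 * 0 + 1))) - of_int (C 0) * Q"
        using nu_1 by (simp add: C_def)
      show "(\<Sum>k<2 * 1 + 1. X ^ k) = X * of_int (int (nu (2 * 1 + 1))) - of_int (C 1) * Q"
        using nu_3 by (simp add: C_def Q_coeffs numeral_eq_Suc of_int_poly one_pCons)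
    qed
    moreover have "C j = c"
      using C[of j] assms(2) True j by simp
    ultimately have "(X - 1) * Q dvd (\<Sum>k<n. X ^ k) - X ^ j * (kappa n * (of_int (int (nu n)) - of_int c * Q))"
      using dvd_add[OF _ shift[of j]] True unfolding j by (fastforce simp: kappa_def algebra_simps)
    then show ?thesis by (rule that)
  next
    case False
    then obtain m where m: "n = 2 * m" by auto
    \<comment> \<open>The shift makes the recurrence start at \<open>n = 2\<close>, where the sum of
      even powers and \<open>nu\<close> are both 1.\<close>
    obtain j where j: "m = j + 1" using m assms(1) by (cases m) auto
    define C where "C i = (int (i + 1) - int (nu (2 * (i + 1)))) div 3" for i
    have C: "int (nu (2 * (i + 1))) = int (i + 1) - 3 * C i" for i
    proof -
      have "3 dvd 2 * (int (i + 1) - int (nu (2 * (i + 1))))"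
        using nu_mod_3[of "2 * (i + 1)"] by simp
      then have "3 dvd int (i + 1) - int (nu (2 * (i + 1)))"
        by presburger
      then show ?thesis by (simp add: C_def)
    qed
    have v: "int (nu (2 * (i + 2 + 1))) = 5 * int (nu (2 * (i + 1 + 1))) - int (nu (2 * (i + 1)))" for i
      using arg_cong[OF nu_rec[of "2 * (i + 1)"], of int]
      by (simp add: algebra_simps numeral_eq_Suc)
    have S: "(\<Sum>k<i + 2 + 1. X ^ (2 * k)) = (1 + X^2) * (\<Sum>k<i + 1 + 1. X ^ (2 * k)) - X^2 * (\<Sum>k<i + 1. X ^ (2 * k))" for i
    proof -
      have "(\<Sum>k<i + 1 + 1. X ^ (2 * k)) = (\<Sum>k<i + 1. X ^ (2 * k)) + X ^ (2 * (i + 1))"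
        by simp
      moreover have "(\<Sum>k<i + 2 + 1. X ^ (2 * k)) = (\<Sum>k<i + 1 + 1. X ^ (2 * k)) + X^2 * X ^ (2 * (i + 1))"
        by (simp flip: power_add add: numeral_eq_Suc)
      moreover have "c = (1 + x) * b - x * a" if "b = a + p" "c = b + x * p" for a b c p x :: "int poly"
        using that by algebra
      ultimately show ?thesis by blast
    qed
    have "(X - 1) * Q dvd (\<Sum>k<j + 1. X ^ (2 * k)) - (X ^ j * of_int (int (nu (2 * (j + 1)))) - of_int (C j) * Q)"
    proof (rule two_step_congruence[where v = "\<lambda>j. int (nu (2 * (j + 1)))", OF S v])
      show "C (i + 2) = 2 * C (i + 1) - C i - int (nu (2 * (i + 1 + 1)))" for i
        using v[of i] C[of i] C[of "i + 1"] C[of "i + 2"] by simp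
      show "(\<Sum>k<0 + 1. X ^ (2 * k)) = of_int (int (nu (2 * (0 + 1)))) - of_int (C 0) * Q"
        using nu_2 by (simp add: C_def)
      show "(\<Sum>k<1 + 1. X ^ (2 * k)) = X * of_int (int (nu (2 * (1 + 1)))) - of_int (C 1) * Q"
        using nu_rec[of 0] nu_0 nu_2 by (simp add: C_def Q_coeffs numeral_eq_Suc of_int_poly one_pCons)
    qed
    moreover have "C j = c"
      using C[of j] assms(2) False m j by simp
    ultimately have "(X - 1) * Q dvd (\<Sum>k<m. X ^ (2 * k)) - (X ^ j * of_int (int (nu n)) - of_int c * Q)"
      unfolding m j by simp
    from dvd_add[OF this shift[of j]]
    have "(X - 1) * Q dvd (\<Sum>k<m. X ^ (2 * k)) - X ^ j * (of_int (int (nu n)) - of_int c * Q)"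
      by (simp add: algebra_simps)
    then have "(X - 1) * Q dvd (1 + X) * ((\<Sum>k<m. X ^ (2 * k)) - X ^ j * (of_int (int (nu n)) - of_int c * Q))"
      by (rule dvd_mult)
    moreover have "(\<Sum>k<2 * m. X ^ k) = (1 + X) * (\<Sum>k<m. X ^ (2 * k))" for m
    proof (induction m)
      case (Suc m)
      have "(\<Sum>k<2 * Suc m. X ^ k) = (\<Sum>k<2 * m. X ^ k) + (1 + X) * X ^ (2 * m)"
        by (simp only: mult_Suc_right add_2_eq_Suc sum.lessThan_Suc power_Suc distrib_right mult_1_left add.assoc)
      then show ?case unfolding Suc by (simp only: sum.lessThan_Suc distrib_left)
    qed simp
    ultimately have "(X - 1) * Q dvd (\<Sum>k<n. X ^ k) - X ^ j * (kappa n * (of_int (int (nu n)) - of_int c * Q))"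
      unfolding m kappa_def by (simp only: right_diff_distrib even_mult_iff even_numeral not_True_eq_False if_False mult.left_commute simp_thms if_True)
    then show ?thesis by (rule that)
  qed
qed

section \<open>Ideal membership as divisibility and lattice conditions\<close>

lemma linear_mod_kappa:
  fixes b0 b1 :: int and n :: nat
  defines "e0 \<equiv> (if odd n then - b0 - b1 else - 2 * b0 - 5 * b1)"
    and "e1 \<equiv> (if odd n then b0 + 4 * b1 else 5 * b0 + 23 * b1)"
  shows "Q dvd (X - 1) * kappa n * (of_int b0 + of_int b1 * X) - (of_int e0 + of_int e1 * X)"
proof -
  \<comment> \<open>Multiplication by \<open>X - 1\<close> or \<open>X^2 - 1\<close> is reduced with
    \<open>X^2 = 5 * X - 1\<close>; \<open>e0\<close> and \<open>e1\<close> are the rows of the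
    resulting matrix.\<close>
  have "(x - 1) * (p + q * x) - ((- p - q) + (p + 4 * q) * x) = r * q"
    "(x - 1) * (1 + x) * (p + q * x) - ((- 2 * p - 5 * q) + (5 * p + 23 * q) * x) = r * (p + q * (x + 5))"
    if "r = x^2 - 5 * x + 1" for x p q r :: "int poly"
    using that by algebra+
  from this[OF Q_def, of "of_int b0" "of_int b1"] show ?thesis
    unfolding e0_def e1_def kappa_def
    by (cases "odd n") (simp_all only: if_True if_False not_False_eq_True not_True_eq_False of_int_add of_int_diff of_int_minus of_int_mult of_int_numeral dvd_triv_left mult_1_right)
qed

text \<open>The weight \<open>13\<close> is the root of \<open>Q\<close> modulo \<open>21\<close>, so that \<open>a + b X \<mapsto> a + 13 b\<close> is a ring homomorphism
  modulo \<open>21\<close>; the ideals of index \<open>3\<close> and \<open>21\<close> generated by \<open>X - 1\<close> and \<open>X\<^sup>2 - 1\<close> are its kernels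
  modulo \<open>3\<close> and \<open>21\<close>.\<close>

lemma linear_lattice:
  fixes a b v :: int
  shows "(\<exists>b0 b1. a = v * (if odd n then - b0 - b1 else - 2 * b0 - 5 * b1) \<and>
      b = v * (if odd n then b0 + 4 * b1 else 5 * b0 + 23 * b1)) \<longleftrightarrow>
    v dvd b \<and> int (3 * mu n) * v dvd a + 13 * b"
proof (cases "odd n")
  case True
  \<comment> \<open>The map to \<open>s = b0 + 4 * b1\<close>, \<open>t = 4 * b0 + 17 * b1\<close>
    has determinant 1, and the witnesses are its inverse. For even \<open>n\<close> the same is done
    with \<open>s = 5 * b0 + 23 * b1\<close>, \<open>t = 3 * b0 + 14 * b1\<close>.\<close>
  have "\<exists>b0 b1. a = v * (- b0 - b1) \<and> b = v * (b0 + 4 * b1)"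
    if b: "b = v * s" and ab: "a + 13 * b = 3 * v * t" for s t
  proof (intro exI conjI)
    show b': "b = v * ((17 * s - 4 * t) + 4 * (t - 4 * s))"
      using b by (simp add: algebra_simps)
    show "a = v * (- (17 * s - 4 * t) - (t - 4 * s))"
      using b ab by (simp add: algebra_simps)
  qed
  moreover have "v * (- b0 - b1) + 13 * (v * (b0 + 4 * b1)) = 3 * v * (4 * b0 + 17 * b1)" for b0 b1
    by (simp add: algebra_simps)
  ultimately have "(\<exists>b0 b1. a = v * (- b0 - b1) \<and> b = v * (b0 + 4 * b1)) \<longleftrightarrow> v dvd b \<and> 3 * v dvd a + 13 * b"
    unfolding dvd_def by metis
  then show ?thesis
    using True by (simp only: mu_def if_True if_False not_False_eq_True not_True_eq_False) simp
next
  case False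
  have "\<exists>b0 b1. a = v * (- 2 * b0 - 5 * b1) \<and> b = v * (5 * b0 + 23 * b1)"
    if b: "b = v * s" and ab: "a + 13 * b = 21 * v * t" for s t
  proof (intro exI conjI)
    show b': "b = v * (5 * (14 * s - 23 * t) + 23 * (5 * t - 3 * s))"
      using b by (simp add: algebra_simps)
    show "a = v * (- 2 * (14 * s - 23 * t) - 5 * (5 * t - 3 * s))"
      using b ab by (simp add: algebra_simps)
  qed
  moreover have "v * (- 2 * b0 - 5 * b1) + 13 * (v * (5 * b0 + 23 * b1)) = 21 * v * (3 * b0 + 14 * b1)" for b0 b1
    by (simp add: algebra_simps)
  ultimately have "(\<exists>b0 b1. a = v * (- 2 * b0 - 5 * b1) \<and> b = v * (5 * b0 + 23 * b1)) \<longleftrightarrow> v dvd b \<and> 21 * v dvd a + 13 * b"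
    unfolding dvd_def by metis
  then show ?thesis
    using False by (simp only: mu_def if_True if_False not_False_eq_True not_True_eq_False) simp
qed

text \<open>Modulo \<open>Q\<close> the term with \<open>c\<close> disappears, so the ideal becomes
  \<open>v\<close> times the image of multiplication by \<open>(X - 1) * kappa n\<close>, a lattice
  in the coordinates \<open>a\<close>, \<open>b\<close>.\<close>

lemma linear_criterion:
  fixes v :: int
  assumes f: "Q dvd f - (of_int a + of_int b * X)"
  shows "(\<exists>A B. f = A * Q + B * ((X - 1) * (kappa n * (of_int v - of_int c * Q)))) \<longleftrightarrow>
    v dvd b \<and> int (3 * mu n) * v dvd a + 13 * b"
proof -
  let ?e0 = "\<lambda>b0 b1. if odd n then - b0 - b1 else - 2 * b0 - 5 * b1 :: int"
  let ?e1 = "\<lambda>b0 b1. if odd n then b0 + 4 * b1 else 5 * b0 + 23 * b1 :: int"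
  let ?H = "(X - 1) * (kappa n * (of_int v - of_int c * Q))"
  have H: "Q dvd B * ?H - (of_int (v * ?e0 b0 b1) + of_int (v * ?e1 b0 b1) * X)"
    if B: "Q dvd B - (of_int b0 + of_int b1 * X)" for B b0 b1
  proof -
    have "Q dvd (B - (of_int b0 + of_int b1 * X)) * ?H +
      (of_int v * ((X - 1) * kappa n * (of_int b0 + of_int b1 * X) - (of_int (?e0 b0 b1) + of_int (?e1 b0 b1) * X)) -
       Q * (of_int c * (of_int b0 + of_int b1 * X) * (X - 1) * kappa n))"
      by (intro dvd_add dvd_diff dvd_mult2[OF B] dvd_mult[OF linear_mod_kappa] dvd_triv_left)
    also have "\<dots> = B * ?H - (of_int (v * ?e0 b0 b1) + of_int (v * ?e1 b0 b1) * X)"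
    proof -
      have "(B - L) * ((x - 1) * (k * (w - d * q))) + (w * ((x - 1) * k * L - (p0 + p1 * x)) - q * (d * L * (x - 1) * k)) =
        B * ((x - 1) * (k * (w - d * q))) - (w * p0 + w * p1 * x)" for B L x k w d q p0 p1 :: "int poly"
        by algebra
      then show ?thesis by (simp only: of_int_mult)
    qed
    finally show ?thesis .
  qed
  have "(\<exists>A B. f = A * Q + B * ?H) \<longleftrightarrow> (\<exists>b0 b1. a = v * ?e0 b0 b1 \<and> b = v * ?e1 b0 b1)"
  proof
    assume "\<exists>A B. f = A * Q + B * ?H"
    then obtain A B where AB: "f = A * Q + B * ?H" by blast
    obtain b0 b1 where B: "Q dvd B - (of_int b0 + of_int b1 * X)"
      using linear_remainder by blast
    have "Q dvd (B * ?H - (of_int (v * ?e0 b0 b1) + of_int (v * ?e1 b0 b1) * X)) + A * Q - (f - (of_int a + of_int b * X))"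
      by (intro dvd_diff dvd_add H B f dvd_triv_right)
    moreover have "(h - (l0 + l1 * x)) + g - (g + h - (a + b * x)) = (a - l0) + (b - l1) * x" for h g l0 l1 a b x :: "int poly"
      by algebra
    ultimately have "Q dvd of_int (a - v * ?e0 b0 b1) + of_int (b - v * ?e1 b0 b1) * X"
      unfolding AB by (simp only: of_int_diff)
    from linear_unique[OF this] show "\<exists>b0 b1. a = v * ?e0 b0 b1 \<and> b = v * ?e1 b0 b1"
      by (intro exI[of _ b0] exI[of _ b1]) simp
  next
    assume "\<exists>b0 b1. a = v * ?e0 b0 b1 \<and> b = v * ?e1 b0 b1"
    then obtain b0 b1 where ab: "a = v * ?e0 b0 b1" "b = v * ?e1 b0 b1" by blast
    let ?B = "of_int b0 + of_int b1 * X"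
    have "Q dvd ?B - ?B" by (simp only: diff_self dvd_0_right)
    from dvd_diff[OF f H[OF this]]
    have "Q dvd (f - (of_int a + of_int b * X)) - (?B * ?H - (of_int a + of_int b * X))"
      by (simp only: ab)
    then have "Q dvd f - ?B * ?H" by (simp only: diff_diff_eq2 diff_add_cancel)
    then obtain A where "f - ?B * ?H = Q * A" by blast
    then have "f = A * Q + ?B * ?H" by (simp only: mult.commute[of A] diff_eq_eq)
    then show "\<exists>A B. f = A * Q + B * ?H" by blast
  qed
  then show ?thesis by (simp only: linear_lattice)
qed

definition span3 :: "int \<times> int \<times> int \<Rightarrow> int \<times> int \<times> int \<Rightarrow> int \<times> int \<times> int \<Rightarrow> int \<Rightarrow> int \<Rightarrow> int \<Rightarrow> bool" where
  "span3 r s t x y z \<longleftrightarrow> (\<exists>i j k.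
     x = i * fst r + j * fst s + k * fst t \<and>
     y = i * fst (snd r) + j * fst (snd s) + k * fst (snd t) \<and>
     z = i * snd (snd r) + j * snd (snd s) + k * snd (snd t))"

text \<open>Since \<open>Q\<close> is -3 at 1, \<open>(v - c * Q) * Q\<close> is
  \<open>(v + 3 * c) * Q\<close> modulo \<open>(X - 1) * Q\<close>. The value of
  \<open>kappa n\<close> at 1 is 1 or 2, so the image of \<open>Q\<close> is \<open>n * Q\<close>.
  In the image of \<open>X - 1\<close> the term with \<open>c\<close> vanishes.\<close>

lemma cubic_mod_kappa:
  fixes b0 b1 b2 v c :: int
  assumes n: "int n = (if odd n then 1 else 2) * (v + 3 * c)"
  defines "x \<equiv> (if odd n then b0 * v else b0 * (2 * v) + b1 * (3 * v))"
    and "y \<equiv> (if odd n then b1 * v else b0 * v + b1 * (5 * v))"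
    and "z \<equiv> (if odd n then b2 * int n - b0 * c else b1 * v - b0 * (2 * c) + b2 * int n)"
  shows "(X - 1) * Q dvd kappa n * (of_int v - of_int c * Q) * (of_int b0 + of_int b1 * (X - 1) + of_int b2 * Q) -
    (of_int x + of_int y * (X - 1) + of_int z * Q)"
proof -
  have ring: "(w - d * q) * (p0 + p1 * (x - 1) + p2 * q) - (p0 * w + p1 * w * (x - 1) + (p2 * (w + 3 * d) - p0 * d) * q)
    = (x - 1) * q * (- d * p1 - d * p2 * (x - 4))"
    "(1 + x) * (w - d * q) * (p0 + p1 * (x - 1) + p2 * q) - ((p0 * (2 * w) + p1 * (3 * w)) +
     (p0 * w + p1 * (5 * w)) * (x - 1) + (p1 * w - p0 * (2 * d) + p2 * (2 * (w + 3 * d))) * q)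
    = (x - 1) * q * (- d * p0 - d * p1 * (x + 1) + p2 * (w - d * (x^2 - 3 * x - 7)))"
    if "q = x^2 - 5 * x + 1" for x q w d p0 p1 p2 :: "int poly"
    using that by algebra+
  show ?thesis
  proof (cases "odd n")
    case True
    then have n': "int n = v + 3 * c" using n by simp
    show ?thesis using True ring(1)[OF Q_def, of "of_int v" "of_int c" "of_int b0" "of_int b1" "of_int b2"]
      unfolding x_def y_def z_def n' kappa_def
      by (simp only: if_True if_False not_False_eq_True not_True_eq_False of_int_add of_int_diff of_int_minus of_int_mult of_int_numeral dvd_triv_left mult_1_left)
  next
    case False
    then have n': "int n = 2 * (v + 3 * c)" using n by simp
    show ?thesis using False ring(2)[OF Q_def, of "of_int v" "of_int c" "of_int b0" "of_int b1" "of_int b2"]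
      unfolding x_def y_def z_def n' kappa_def
      by (simp only: if_True if_False not_False_eq_True not_True_eq_False of_int_add of_int_diff of_int_minus of_int_mult of_int_numeral dvd_triv_left mult_1_left)
  qed
qed

text \<open>Both generators are multiples of \<open>X - 1\<close>, which forces the value
  \<open>d\<close> at 1 to be 0. Cancelling \<open>X - 1\<close> leaves the lattice spanned by the
  images of \<open>1\<close>, \<open>X - 1\<close> and \<open>Q\<close> in
  \<open>cubic_mod_kappa\<close>.\<close>

lemma cubic_criterion:
  fixes v c :: int
  assumes n: "int n = (if odd n then 1 else 2) * (v + 3 * c)"
    and S: "(X - 1) * Q * (X - 1) dvd S - cubic d x y z"
  shows "(\<exists>A B. S = A * ((X - 1) * Q * (X - 1)) + B * (kappa n * (of_int v - of_int c * Q) * (X - 1))) \<longleftrightarrow>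
    d = 0 \<and> (if odd n then span3 (v, 0, - c) (0, v, 0) (0, 0, int n) x y z
      else span3 (2 * v, v, - 2 * c) (3 * v, 5 * v, v) (0, 0, int n) x y z)"
proof -
  let ?H = "kappa n * (of_int v - of_int c * Q)" and ?P = "(X - 1) * Q"
  let ?x = "\<lambda>b0 b1 b2. if odd n then b0 * v else b0 * (2 * v) + b1 * (3 * v)"
  let ?y = "\<lambda>b0 b1 b2. if odd n then b1 * v else b0 * v + b1 * (5 * v)"
  let ?z = "\<lambda>b0 b1 b2. if odd n then b2 * int n - b0 * c else b1 * v - b0 * (2 * c) + b2 * int n"
  let ?c = "\<lambda>x y z. of_int x + of_int y * (X - 1) + of_int z * Q :: int poly"
  have H: "?P * (X - 1) dvd B * (?H * (X - 1)) - cubic 0 (?x b0 b1 b2) (?y b0 b1 b2) (?z b0 b1 b2)"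
    if B: "?P dvd B - ?c b0 b1 b2" for B b0 b1 b2
  proof -
    have "?P dvd ?H * (B - ?c b0 b1 b2) + (?H * ?c b0 b1 b2 - ?c (?x b0 b1 b2) (?y b0 b1 b2) (?z b0 b1 b2))"
      by (intro dvd_add dvd_mult[OF B] cubic_mod_kappa n)
    then have "?P * (X - 1) dvd (B * ?H - ?c (?x b0 b1 b2) (?y b0 b1 b2) (?z b0 b1 b2)) * (X - 1)"
    proof (intro mult_dvd_mono dvd_refl)
      have "h * (b - q) + (h * q - r) = b * h - r" for h b q r :: "int poly"
        by algebra
      then show "?P dvd B * ?H - ?c (?x b0 b1 b2) (?y b0 b1 b2) (?z b0 b1 b2)"
        using \<open>?P dvd ?H * (B - ?c b0 b1 b2) + _\<close> by (simp only:)
    qed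
    moreover have "(B * h - q) * (X - 1) = B * (h * (X - 1)) - (of_int 0 + q * (X - 1))" for h q :: "int poly"
      by (simp only: of_int_0 left_diff_distrib mult.assoc add_0_left)
    ultimately show ?thesis by (simp only:)
  qed
  \<comment> \<open>Remainders modulo \<open>?P\<close> come from dividing
    \<open>B * (X - 1)\<close> by \<open>?P * (X - 1)\<close>: the constant \<open>e\<close> is
    divisible by \<open>X - 1\<close>, hence 0, and \<open>X - 1\<close> cancels.\<close>
  have rem: "\<exists>b0 b1 b2. ?P dvd B - ?c b0 b1 b2" for B
  proof -
    obtain e b0 b1 b2 where "?P * (X - 1) dvd B * (X - 1) - cubic e b0 b1 b2"
      using cubic_remainder by blast
    moreover from this have "X - 1 dvd B * (X - 1) - cubic e b0 b1 b2"
      by (rule dvd_mult_right)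
    then have "X - 1 dvd - of_int e"
    proof -
      have "B * (X - 1) - cubic e b0 b1 b2 - (B - ?c b0 b1 b2) * (X - 1) = - of_int e"
        by (simp only: left_diff_distrib)
      then show ?thesis
        using \<open>X - 1 dvd B * (X - 1) - cubic e b0 b1 b2\<close> by (metis dvd_diff dvd_triv_right)
    qed
    then have "X - 1 dvd of_int e" by (simp only: dvd_minus_iff)
    then have "(of_int e :: int poly) = 0"
      by (rule monic_dvd_low_degree) (simp add: one_pCons of_int_poly)
    then have "B * (X - 1) - cubic e b0 b1 b2 = (B - ?c b0 b1 b2) * (X - 1)"
      by (simp only: left_diff_distrib add_0_left)
    ultimately have "?P * (X - 1) dvd (B - ?c b0 b1 b2) * (X - 1)"
      by (simp only:)
    moreover have "X - 1 \<noteq> 0" by (simp add: one_pCons)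
    ultimately have "?P dvd B - ?c b0 b1 b2" by (simp only: dvd_mult_cancel_right simp_thms)
    then show ?thesis by (intro exI)
  qed
  have cubic_diff: "cubic d x y z - cubic d' x' y' z' = cubic (d - d') (x - x') (y - y') (z - z')" for d x y z d' x' y' z'
  proof -
    have "(d + (x + y * (t - 1) + z * q) * (t - 1)) - (d' + (x' + y' * (t - 1) + z' * q) * (t - 1)) =
      (d - d') + ((x - x') + (y - y') * (t - 1) + (z - z') * q) * (t - 1)"
      for d x y z d' x' y' z' t q :: "int poly"
      by algebra
    then show ?thesis by (simp only: of_int_diff)
  qed
  have "(\<exists>A B. S = A * (?P * (X - 1)) + B * (?H * (X - 1))) \<longleftrightarrow>
    d = 0 \<and> (\<exists>b0 b1 b2. x = ?x b0 b1 b2 \<and> y = ?y b0 b1 b2 \<and> z = ?z b0 b1 b2)"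
  proof
    assume "\<exists>A B. S = A * (?P * (X - 1)) + B * (?H * (X - 1))"
    then obtain A B where AB: "S = A * (?P * (X - 1)) + B * (?H * (X - 1))" by blast
    obtain b0 b1 b2 where B: "?P dvd B - ?c b0 b1 b2"
      using rem by blast
    have "?P * (X - 1) dvd (B * (?H * (X - 1)) - cubic 0 (?x b0 b1 b2) (?y b0 b1 b2) (?z b0 b1 b2)) +
        A * (?P * (X - 1)) - (S - cubic d x y z)"
      by (intro dvd_diff dvd_add H B S dvd_triv_right)
    also have "\<dots> = cubic d x y z - cubic 0 (?x b0 b1 b2) (?y b0 b1 b2) (?z b0 b1 b2)"
    proof -
      have "(h - c0) + g - (g + h - c1) = c1 - c0" for h g c0 c1 :: "int poly"
        by algebra
      then show ?thesis unfolding AB by (simp only:)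
    qed
    finally have "?P * (X - 1) dvd cubic (d - 0) (x - ?x b0 b1 b2) (y - ?y b0 b1 b2) (z - ?z b0 b1 b2)"
      by (simp only: cubic_diff)
    from cubic_unique[OF this] show "d = 0 \<and> (\<exists>b0 b1 b2. x = ?x b0 b1 b2 \<and> y = ?y b0 b1 b2 \<and> z = ?z b0 b1 b2)"
      by (intro conjI exI[of _ b0] exI[of _ b1] exI[of _ b2]) (simp_all only: right_minus_eq)
  next
    assume "d = 0 \<and> (\<exists>b0 b1 b2. x = ?x b0 b1 b2 \<and> y = ?y b0 b1 b2 \<and> z = ?z b0 b1 b2)"
    then obtain b0 b1 b2 where xyz: "d = 0" "x = ?x b0 b1 b2" "y = ?y b0 b1 b2" "z = ?z b0 b1 b2" by blast
    let ?B = "?c b0 b1 b2"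
    have "?P dvd ?B - ?B" by (simp only: diff_self dvd_0_right)
    from dvd_diff[OF S H[OF this]]
    have "?P * (X - 1) dvd (S - cubic d x y z) - (?B * (?H * (X - 1)) - cubic d x y z)"
      by (simp only: xyz)
    then have "?P * (X - 1) dvd S - ?B * (?H * (X - 1))" by (simp only: diff_diff_eq2 diff_add_cancel)
    then obtain A where "S - ?B * (?H * (X - 1)) = ?P * (X - 1) * A" by blast
    then have "S = A * (?P * (X - 1)) + ?B * (?H * (X - 1))" by (simp only: mult.commute[of A] diff_eq_eq)
    then show "\<exists>A B. S = A * (?P * (X - 1)) + B * (?H * (X - 1))" by blast
  qed
  also have "\<dots> \<longleftrightarrow> d = 0 \<and> (if odd n then span3 (v, 0, - c) (0, v, 0) (0, 0, int n) x y z
      else span3 (2 * v, v, - 2 * c) (3 * v, 5 * v, v) (0, 0, int n) x y z)"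
    by (cases "odd n") (auto simp: span3_def algebra_simps)
  finally show ?thesis by (simp only: mult.assoc)
qed

section \<open>The Laplacian in terms of polynomials\<close>

lemma pverts_Delta111: "pverts (Delta111 n) = {1, 2, 3} \<times> {0..<int n}"
  by (simp add: Delta111_def)

lemma carrier_int_vectors: "carrier (int_vectors G) = (pverts G \<rightarrow>\<^sub>E UNIV)"
  by (simp add: int_vectors_def product_group_def)

lemma mult_int_vectors:
  "z \<otimes>\<^bsub>int_vectors G\<^esub> w = (\<lambda>v\<in>pverts G. z v + w v)"
  by (simp add: int_vectors_def product_group_def)

lemma neighbours_Delta111:
  assumes "n \<ge> 3" "x \<in> {1, 2, 3}" "y \<in> {0..<int n}"
  shows "{v. ((x, y), v) \<in> parcs (Delta111 n)} =
    {(x, (y + 1) mod int n), (x, (y - 1) mod int n)} \<union> ({1, 2, 3} - {x}) \<times> {y}"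
proof -
  have "y' \<in> {0..<int n} \<and> [y' = t] (mod int n) \<longleftrightarrow> y' = t mod int n" for y' t
    using assms(1) by (auto simp: cong_def)
  then show ?thesis
    using assms(2,3) by (auto simp: Delta111_def)
qed

text \<open>The degree is 4. Subtracting the whole triangle, the vertex itself included, raises the
  diagonal coefficient to 5 and makes the coupling term independent of \<open>x\<close>.\<close>

lemma laplacian_Delta111_apply:
  assumes "n \<ge> 3" "x \<in> {1, 2, 3}" "y \<in> {0..<int n}"
  shows "(\<Sum>v\<in>pverts (Delta111 n). laplacian (Delta111 n) (x, y) v * z v) =
    5 * z (x, y) - z (x, (y + 1) mod int n) - z (x, (y - 1) mod int n) - (z (1, y) + z (2, y) + z (3, y))"
proof -
  let ?D = "Delta111 n" and ?u = "(x, y)"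
  let ?N = "{v. (?u, v) \<in> parcs ?D}"
  have V: "?u \<in> pverts ?D" and finV: "finite (pverts ?D)"
    using assms by (simp_all add: pverts_Delta111)
  have N: "?N = {(x, (y + 1) mod int n), (x, (y - 1) mod int n)} \<union> ({1, 2, 3} - {x}) \<times> {y}"
    by (rule neighbours_Delta111[OF assms])
  \<comment> \<open>Here \<open>n \<ge> 3\<close> matters: the two neighbours along the cycle differ
    because \<open>n\<close> does not divide 2.\<close>
  have ne: "(y + 1) mod int n \<noteq> (y - 1) mod int n" "(y + 1) mod int n \<noteq> y" "(y - 1) mod int n \<noteq> y"
  proof -
    have "\<not> int n dvd 2" "\<not> int n dvd 1" using assms(1) by (auto dest: zdvd_imp_le)
    then show "(y + 1) mod int n \<noteq> (y - 1) mod int n"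
      by (simp add: mod_eq_dvd_iff)
    have "y mod int n = y" using assms(3) by simp
    then show "(y + 1) mod int n \<noteq> y" "(y - 1) mod int n \<noteq> y"
      using \<open>\<not> int n dvd 1\<close> mod_eq_dvd_iff[of "y + 1" "int n" y] mod_eq_dvd_iff[of "y - 1" "int n" y]
      by auto
  qed
  have sumN: "(\<Sum>v\<in>?N. f v) = f (x, (y + 1) mod int n) + f (x, (y - 1) mod int n) + (\<Sum>x'\<in>{1, 2, 3} - {x}. f (x', y))"
    for f :: "nat \<times> int \<Rightarrow> int"
  proof -
    have "(\<Sum>v\<in>?N. f v) = (\<Sum>v\<in>{(x, (y + 1) mod int n), (x, (y - 1) mod int n)}. f v) + (\<Sum>v\<in>({1, 2, 3} - {x}) \<times> {y}. f v)"
      unfolding N by (rule sum.union_disjoint) auto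
    also have "(\<Sum>v\<in>({1, 2, 3} - {x}) \<times> {y}. f v) = (\<Sum>x'\<in>{1, 2, 3} - {x}. f (x', y))"
    proof -
      have "({1, 2, 3} - {x}) \<times> {y} = (\<lambda>x'. (x', y)) ` ({1, 2, 3} - {x})" by auto
      then show ?thesis by (simp add: sum.reindex inj_on_def)
    qed
    finally show ?thesis using ne(1) by simp
  qed
  have "out_degree (with_proj ?D) ?u = card ?N"
  proof -
    have "out_arcs (with_proj ?D) ?u = Pair ?u ` ?N" by (auto simp: out_arcs_def)
    then show ?thesis by (simp add: out_degree_def card_image inj_on_def)
  qed
  also have "int (card ?N) = 4"
    using sumN[of "\<lambda>_. 1"] assms(2) by auto
  finally have deg: "int (out_degree (with_proj ?D) ?u) = 4" by simp
  have "(\<Sum>v\<in>pverts ?D. laplacian ?D ?u v * z v) =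
      (\<Sum>v\<in>pverts ?D. (if ?u = v then 4 * z v else 0) - (if (?u, v) \<in> parcs ?D then z v else 0))"
    by (rule sum.cong) (auto simp: laplacian_def deg[simplified])
  also have "\<dots> = 4 * z ?u - (\<Sum>v\<in>pverts ?D. if (?u, v) \<in> parcs ?D then z v else 0)"
    using V finV by (simp add: sum_subtractf)
  also have "(\<Sum>v\<in>pverts ?D. if (?u, v) \<in> parcs ?D then z v else 0) = (\<Sum>v\<in>?N. z v)"
  proof -
    have "?N \<subseteq> pverts ?D" by (auto simp: Delta111_def Let_def)
    then show ?thesis using finV by (auto simp: sum.If_cases Int_absorb1 intro!: sum.cong)
  qed
  also have "\<dots> = z (x, (y + 1) mod int n) + z (x, (y - 1) mod int n) + (z (1, y) + z (2, y) + z (3, y) - z (x, y))"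
    unfolding sumN using assms(2) by (subst sum_diff1) auto
  finally show ?thesis by simp
qed

definition row_poly :: "nat \<Rightarrow> (int \<Rightarrow> int) \<Rightarrow> int poly" where
  "row_poly n g = (\<Sum>y<n. of_int (g (int y)) * X ^ y)"

lemma row_poly_monom: "row_poly n g = (\<Sum>y<n. monom (g (int y)) y)"
  unfolding row_poly_def by (simp add: monom_altdef of_int_poly)

lemma coeff_row_poly: "coeff (row_poly n g) i = (if i < n then g (int i) else 0)"
  by (simp add: row_poly_monom coeff_sum)

lemma row_poly_add: "row_poly n (\<lambda>y. g y + h y) = row_poly n g + row_poly n h"
  by (rule poly_eqI) (simp add: coeff_row_poly)

lemma row_poly_diff: "row_poly n (\<lambda>y. g y - h y) = row_poly n g - row_poly n h"
  by (rule poly_eqI) (simp add: coeff_row_poly)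

lemma row_poly_mult_5: "row_poly n (\<lambda>y. 5 * g y) = 5 * row_poly n g"
  by (rule poly_eqI) (simp add: coeff_row_poly numeral_poly)

lemma degree_row_poly: "n > 0 \<Longrightarrow> degree (row_poly n g) < n"
  by (rule le_less_trans[OF degree_le[of "n - 1"]]) (auto simp: coeff_row_poly)

lemma X_power_minus_1: "n > 0 \<Longrightarrow> lead_coeff (X ^ n - 1) = 1" "n > 0 \<Longrightarrow> degree (X ^ n - 1) = n"
proof -
  assume n: "n > 0"
  have "X ^ n = monom 1 n" by (simp add: monom_altdef)
  then have "degree (X ^ n) = n" "coeff (X ^ n) n = 1"
    by (simp_all add: degree_monom_eq)
  then show "degree (X ^ n - 1) = n"
    using n by (simp only: degree_1 diff_conv_add_uminus degree_minus degree_add_eq_left)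
  then show "lead_coeff (X ^ n - 1) = 1"
    using n \<open>coeff (X ^ n) n = 1\<close> by (simp only: coeff_diff) simp
qed

lemma row_poly_cong:
  assumes "n > 0" "X ^ n - 1 dvd row_poly n g - row_poly n h" "y \<in> {0..<int n}"
  shows "g y = h y"
proof -
  have "row_poly n g - row_poly n h = 0"
  proof (rule monic_dvd_low_degree[OF assms(2)])
    show "degree (row_poly n g - row_poly n h) < degree (X ^ n - 1)"
      unfolding X_power_minus_1(2)[OF assms(1)]
      by (intro degree_diff_less degree_row_poly assms)
  qed
  then have "coeff (row_poly n g) (nat y) = coeff (row_poly n h) (nat y)" by simp
  moreover have "nat y < n" "int (nat y) = y" using assms(3) by auto
  ultimately show ?thesis by (simp only: coeff_row_poly if_True)
qed

lemma row_poly_exists: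
  assumes "n > 0"
  obtains g where "X ^ n - 1 dvd f - row_poly n g"
proof -
  obtain r where r: "X ^ n - 1 dvd f - r" "degree r < n"
    using monic_remainder[of "X ^ n - 1" f] X_power_minus_1[OF assms] assms by metis
  have "r = row_poly n (\<lambda>y. coeff r (nat y))"
    using r(2) by (intro poly_eqI) (auto simp: coeff_row_poly coeff_eq_0)
  then show ?thesis using r(1) that by metis
qed

lemma row_poly_shift_down:
  assumes "n > 0"
  shows "X ^ n - 1 dvd row_poly n (\<lambda>y. g ((y - 1) mod int n)) - X * row_poly n g"
proof -
  obtain m where m: "n = Suc m" using assms by (cases n) auto
  have "row_poly n (\<lambda>y. g ((y - 1) mod int n)) = of_int (g (int m)) + (\<Sum>y<m. of_int (g (int y)) * X ^ Suc y)"
    unfolding row_poly_def m sum.lessThan_Suc_shift by (simp add: zmod_minus1)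
  moreover have "X * row_poly n g = (\<Sum>y<m. of_int (g (int y)) * X ^ Suc y) + of_int (g (int m)) * X ^ n"
    unfolding row_poly_def m sum.lessThan_Suc distrib_left sum_distrib_left power_Suc
    by (simp only: mult.left_commute)
  ultimately have "row_poly n (\<lambda>y. g ((y - 1) mod int n)) - X * row_poly n g = (X ^ n - 1) * - of_int (g (int m))"
  proof -
    have "(a + b) - (b + a * x) = (x - 1) * - a" for a b x :: "int poly"
      by algebra
    then show ?thesis
      using \<open>row_poly n (\<lambda>y. g ((y - 1) mod int n)) = _\<close> \<open>X * row_poly n g = _\<close> by (simp only:)
  qed
  then show ?thesis by (simp only: dvd_triv_left)
qed

text \<open>\<open>X ^ (n - 1)\<close> inverts \<open>X\<close> modulo \<open>X ^ n - 1\<close>, so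
  \<open>row_poly_shift_down\<close> for the shifted function can be solved for it.\<close>

lemma row_poly_shift_up:
  assumes "n > 0"
  shows "X ^ n - 1 dvd row_poly n (\<lambda>y. g ((y + 1) mod int n)) - X ^ (n - 1) * row_poly n g"
proof -
  let ?h = "\<lambda>y. g ((y + 1) mod int n)"
  have "row_poly n (\<lambda>y. ?h ((y - 1) mod int n)) = row_poly n g"
    by (rule poly_eqI) (auto simp: coeff_row_poly mod_simps)
  then have "X ^ n - 1 dvd row_poly n g - X * row_poly n ?h"
    using row_poly_shift_down[OF assms, of ?h] by simp
  then obtain k where "row_poly n g - X * row_poly n ?h = (X ^ n - 1) * k" by blast
  moreover have "h - u * p = (x * u - 1) * (- h - u * k)" if "p - x * h = (x * u - 1) * k" for h u p x k :: "int poly"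
    using that by algebra
  moreover have "X ^ n = X * X ^ (n - 1)" using assms by (cases n) simp_all
  ultimately show ?thesis by (metis dvd_triv_left)
qed

definition z_row :: "nat \<Rightarrow> (nat \<times> int \<Rightarrow> int) \<Rightarrow> nat \<Rightarrow> int poly" where
  "z_row n z x = row_poly n (\<lambda>y. z (x, y))"

text \<open>Modulo \<open>X ^ n - 1\<close> this is \<open>X\<close> plus its inverse, the adjacency
  operator of the cycle.\<close>

abbreviation (input) adj :: "nat \<Rightarrow> int poly" where "adj n \<equiv> X + X ^ (n - 1)"

lemma laplacian_map_row:
  assumes "n \<ge> 3" "x \<in> {1, 2, 3}"
  shows "X ^ n - 1 dvd z_row n (laplacian_map (Delta111 n) z) x -
    ((5 - adj n) * z_row n z x - (z_row n z 1 + z_row n z 2 + z_row n z 3))"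
proof -
  have n: "n > 0" using assms by simp
  have "z_row n (laplacian_map (Delta111 n) z) x =
    row_poly n (\<lambda>y. 5 * z (x, y) - z (x, (y + 1) mod int n) - z (x, (y - 1) mod int n) - (z (1, y) + z (2, y) + z (3, y)))"
  proof -
    have "laplacian_map (Delta111 n) z (x, y) =
      5 * z (x, y) - z (x, (y + 1) mod int n) - z (x, (y - 1) mod int n) - (z (1, y) + z (2, y) + z (3, y))"
      if "y \<in> {0..<int n}" for y
      using laplacian_Delta111_apply[OF assms that, of z] assms(2) that
      unfolding laplacian_map_def by (subst restrict_apply') (auto simp: pverts_Delta111)
    then show ?thesis
      unfolding z_row_def row_poly_def by (intro sum.cong) simp_all
  qed
  also have "\<dots> = 5 * z_row n z x - row_poly n (\<lambda>y. z (x, (y + 1) mod int n)) - row_poly n (\<lambda>y. z (x, (y - 1) mod int n))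
      - (z_row n z 1 + z_row n z 2 + z_row n z 3)"
    by (simp only: row_poly_diff row_poly_add row_poly_mult_5 z_row_def)
  finally have L: "z_row n (laplacian_map (Delta111 n) z) x = \<dots>" .
  have "X ^ n - 1 dvd - (row_poly n (\<lambda>y. z (x, (y + 1) mod int n)) - X ^ (n - 1) * row_poly n (\<lambda>y. z (x, y)))
      - (row_poly n (\<lambda>y. z (x, (y - 1) mod int n)) - X * row_poly n (\<lambda>y. z (x, y)))"
    by (intro dvd_diff row_poly_shift_down[OF n, of "\<lambda>y. z (x, y)"])
      (simp only: dvd_minus_iff row_poly_shift_up[OF n, of "\<lambda>y. z (x, y)"])
  moreover have "- (up - u * p) - (dn - x * p) = (5 * p - up - dn - s) - ((5 - (x + u)) * p - s)"
    for up dn u p x s :: "int poly"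
    by algebra
  ultimately show ?thesis unfolding L by (simp only: z_row_def)
qed

lemma vector_exists:
  assumes "n > 0"
  obtains z where "z \<in> carrier (int_vectors (Delta111 n))"
    "X ^ n - 1 dvd p1 - z_row n z 1" "X ^ n - 1 dvd p2 - z_row n z 2" "X ^ n - 1 dvd p3 - z_row n z 3"
proof -
  obtain g1 g2 g3 where g: "X ^ n - 1 dvd p1 - row_poly n g1" "X ^ n - 1 dvd p2 - row_poly n g2"
    "X ^ n - 1 dvd p3 - row_poly n g3"
    using row_poly_exists[OF assms] by metis
  define z where "z = (\<lambda>(x, y)\<in>pverts (Delta111 n). if x = 1 then g1 y else if x = 2 then g2 y else g3 y)"
  have "z_row n z 1 = row_poly n g1" "z_row n z 2 = row_poly n g2" "z_row n z 3 = row_poly n g3"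
    by (auto simp: z_row_def z_def pverts_Delta111 row_poly_def intro!: sum.cong)
  moreover have "z \<in> carrier (int_vectors (Delta111 n))"
    by (simp add: carrier_int_vectors z_def)
  ultimately show ?thesis using that g by metis
qed

text \<open>Modulo \<open>x * u - 1\<close>, \<open>5 - (x + u)\<close> is \<open>- u * q\<close>
  and \<open>2 - (x + u)\<close> is \<open>- u * (x - 1)^2\<close>. The coupling sum cancels in
  \<open>p2 - p3\<close>. In the second combination it cancels too, because adding the three rows
  multiplies it by \<open>2 - (x + u)\<close>; only the product of both factors with
  \<open>w3\<close> remains.\<close>

lemma laplacian_forward_ring:
  fixes p1 p2 p3 q x u w1 w2 w3 k1 k2 k3 :: "int poly"
  assumes p1: "p1 = (5 - (x + u)) * w1 - (w1 + w2 + w3) + (x * u - 1) * k1"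
    and p2: "p2 = (5 - (x + u)) * w2 - (w1 + w2 + w3) + (x * u - 1) * k2"
    and p3: "p3 = (5 - (x + u)) * w3 - (w1 + w2 + w3) + (x * u - 1) * k3"
    and q: "q = x^2 - 5 * x + 1"
  shows "\<exists>A B. p2 - p3 = A * q + B * (x * u - 1)"
    and "\<exists>A B. p1 + p2 + p3 + (2 - (x + u)) * p3 = A * ((x - 1) * q * (x - 1)) + B * (x * u - 1)"
proof -
  have E: "5 - (x + u) = - u * q + (x - 5) * (x * u - 1)"
    unfolding q by algebra
  have "p2 - p3 = (5 - (x + u)) * (w2 - w3) + (k2 - k3) * (x * u - 1)"
    unfolding p2 p3 by algebra
  also have "\<dots> = (- u * (w2 - w3)) * q + ((x - 5) * (w2 - w3) + (k2 - k3)) * (x * u - 1)"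
    unfolding E by algebra
  finally show "\<exists>A B. p2 - p3 = A * q + B * (x * u - 1)" by blast
  have "p1 + p2 + p3 + (2 - (x + u)) * p3 =
      (2 - (x + u)) * ((5 - (x + u)) * w3) + (k1 + k2 + k3 + (2 - (x + u)) * k3) * (x * u - 1)"
    unfolding p1 p2 p3 by algebra
  also have "\<dots> = (- u * (x - 1)^2 + (x - 2) * (x * u - 1)) * ((- u * q + (x - 5) * (x * u - 1)) * w3) +
      (k1 + k2 + k3 + (2 - (x + u)) * k3) * (x * u - 1)"
  proof -
    have "2 - (x + u) = - u * (x - 1)^2 + (x - 2) * (x * u - 1)"
      by algebra
    then show ?thesis using E by simp
  qed
  also have "\<dots> = (u^2 * w3) * ((x - 1) * q * (x - 1)) +
      (- u * (x - 1)^2 * (x - 5) * w3 + (x - 2) * (- u * q + (x - 5) * (x * u - 1)) * w3 +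
       (k1 + k2 + k3 + (2 - (x + u)) * k3)) * (x * u - 1)"
    by algebra
  finally show "\<exists>A B. p1 + p2 + p3 + (2 - (x + u)) * p3 = A * ((x - 1) * q * (x - 1)) + B * (x * u - 1)"
    by blast
qed

text \<open>The witnesses undo the forward computation: \<open>x^2\<close> and \<open>- x\<close>
  invert the factors \<open>u^2\<close> and \<open>- u\<close> met there, and \<open>w1\<close> is
  chosen so that the third row holds exactly.\<close>

lemma laplacian_backward_ring:
  fixes p1 p2 p3 q x u w1 w2 w3 A B A' B' :: "int poly"
  assumes f: "p2 - p3 = A * q + B * (x * u - 1)"
    and S: "p1 + p2 + p3 + (2 - (x + u)) * p3 = A' * ((x - 1) * q * (x - 1)) + B' * (x * u - 1)"
    and q: "q = x^2 - 5 * x + 1"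
    and w3: "w3 = x^2 * A'" and w2: "w2 = w3 - x * A"
    and w1: "w1 = (5 - (x + u)) * w3 - p3 - w2 - w3"
  shows "x * u - 1 dvd p1 - ((5 - (x + u)) * w1 - (w1 + w2 + w3))"
    and "x * u - 1 dvd p2 - ((5 - (x + u)) * w2 - (w1 + w2 + w3))"
    and "x * u - 1 dvd p3 - ((5 - (x + u)) * w3 - (w1 + w2 + w3))"
proof -
  have s: "w1 + w2 + w3 = (5 - (x + u)) * w3 - p3"
    unfolding w1 by algebra
  then show "x * u - 1 dvd p3 - ((5 - (x + u)) * w3 - (w1 + w2 + w3))" by simp
  have p2: "p2 = p3 + A * q + B * (x * u - 1)"
    using f by (simp add: algebra_simps)
  have "p2 - ((5 - (x + u)) * w2 - (w1 + w2 + w3)) = (x * u - 1) * (B - A)"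
    unfolding s unfolding p2 unfolding q w2 by algebra
  then show "x * u - 1 dvd p2 - ((5 - (x + u)) * w2 - (w1 + w2 + w3))" by simp
  have p1: "p1 = A' * ((x - 1) * q * (x - 1)) + B' * (x * u - 1) - p2 - p3 - (2 - (x + u)) * p3"
    using S by (simp add: algebra_simps)
  have sq: "(x - 1) * q * (x - 1) = x^2 * ((5 - (x + u)) * (2 - (x + u))) +
      (x * u - 1) * (x * (2 - (x + u)) + x * (5 - (x + u)) + (x * u - 1))"
    unfolding q by algebra
  have "p1 - ((5 - (x + u)) * w1 - (w1 + w2 + w3)) =
      (x * u - 1) * (A' * (x * (2 - (x + u)) + x * (5 - (x + u)) + (x * u - 1)) + B' - (B - A))"
    unfolding s unfolding p1 unfolding sq unfolding p2 unfolding w1 unfolding w2 unfolding w3 unfolding q by algebra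
  then show "x * u - 1 dvd p1 - ((5 - (x + u)) * w1 - (w1 + w2 + w3))" by simp
qed

text \<open>The three coupled rows separate into two independent ideal memberships, one for each
  summand of the cokernel.\<close>

lemma laplacian_image_iff:
  assumes n: "n \<ge> 3" and z: "z \<in> carrier (int_vectors (Delta111 n))"
  shows "z \<in> laplacian_map (Delta111 n) ` carrier (int_vectors (Delta111 n)) \<longleftrightarrow>
    (\<exists>A B. z_row n z 2 - z_row n z 3 = A * Q + B * (X ^ n - 1)) \<and>
    (\<exists>A B. z_row n z 1 + z_row n z 2 + z_row n z 3 + (2 - adj n) * z_row n z 3 =
      A * ((X - 1) * Q * (X - 1)) + B * (X ^ n - 1))"
proof -
  let ?u = "X ^ (n - 1)"
  have Xn: "X ^ n - 1 = X * ?u - 1" using n by (cases n) simp_all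
  show ?thesis
  proof (intro iffI conjI)
    assume "z \<in> laplacian_map (Delta111 n) ` carrier (int_vectors (Delta111 n))"
    then obtain w where w: "z = laplacian_map (Delta111 n) w" by blast
    have dvd_expand: "\<exists>k. p = r + m * k" if "m dvd p - r" for p r m :: "int poly"
    proof -
      from that obtain k where "p - r = m * k" by (rule dvdE)
      then show ?thesis by (metis diff_eq_eq add.commute)
    qed
    note rows = dvd_expand[OF laplacian_map_row[OF n, of _ w], folded w, unfolded Xn]
    obtain k1 where k1: "z_row n z 1 = (5 - adj n) * z_row n w 1 - (z_row n w 1 + z_row n w 2 + z_row n w 3) + (X * ?u - 1) * k1"
      by (rule exE[OF rows[of 1]], simp, rule that, assumption)
    obtain k2 where k2: "z_row n z 2 = (5 - adj n) * z_row n w 2 - (z_row n w 1 + z_row n w 2 + z_row n w 3) + (X * ?u - 1) * k2"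
      by (rule exE[OF rows[of 2]], simp, rule that, assumption)
    obtain k3 where k3: "z_row n z 3 = (5 - adj n) * z_row n w 3 - (z_row n w 1 + z_row n w 2 + z_row n w 3) + (X * ?u - 1) * k3"
      by (rule exE[OF rows[of 3]], simp, rule that, assumption)
    note k = k1 k2 k3
    from laplacian_forward_ring(1)[OF k Q_def] show "\<exists>A B. z_row n z 2 - z_row n z 3 = A * Q + B * (X ^ n - 1)"
      unfolding Xn .
    from laplacian_forward_ring(2)[OF k Q_def]
    show "\<exists>A B. z_row n z 1 + z_row n z 2 + z_row n z 3 + (2 - adj n) * z_row n z 3 =
      A * ((X - 1) * Q * (X - 1)) + B * (X ^ n - 1)" unfolding Xn .
  next
    assume *: "(\<exists>A B. z_row n z 2 - z_row n z 3 = A * Q + B * (X ^ n - 1)) \<and>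
      (\<exists>A B. z_row n z 1 + z_row n z 2 + z_row n z 3 + (2 - adj n) * z_row n z 3 =
      A * ((X - 1) * Q * (X - 1)) + B * (X ^ n - 1))"
    then obtain A B A' B' where AB:
      "z_row n z 2 - z_row n z 3 = A * Q + B * (X * ?u - 1)"
      "z_row n z 1 + z_row n z 2 + z_row n z 3 + (2 - adj n) * z_row n z 3 =
        A' * ((X - 1) * Q * (X - 1)) + B' * (X * ?u - 1)"
      unfolding Xn by blast
    define w3 where "w3 = X^2 * A'"
    define w2 where "w2 = w3 - X * A"
    define w1 where "w1 = (5 - adj n) * w3 - z_row n z 3 - w2 - w3"
    obtain w where w: "w \<in> carrier (int_vectors (Delta111 n))"
      "X ^ n - 1 dvd w1 - z_row n w 1" "X ^ n - 1 dvd w2 - z_row n w 2" "X ^ n - 1 dvd w3 - z_row n w 3"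
      using n vector_exists[of n w1 w2 w3] by auto
    have main: "X ^ n - 1 dvd z_row n z x - z_row n (laplacian_map (Delta111 n) w) x" if x: "x \<in> {1, 2, 3}" for x
    proof -
      define ww where "ww i = (if i = 1 then w1 else if i = 2 then w2 else w3)" for i :: nat
      have ww: "X ^ n - 1 dvd ww x - z_row n w x"
        using x w by (auto simp: ww_def)
      have z1: "X ^ n - 1 dvd z_row n z x - ((5 - adj n) * ww x - (w1 + w2 + w3))"
        using laplacian_backward_ring[OF AB Q_def w3_def w2_def w1_def, folded Xn] x
        by (auto simp only: ww_def insert_iff empty_iff split: if_splits)
      have "X ^ n - 1 dvd (z_row n z x - ((5 - adj n) * ww x - (w1 + w2 + w3)))
        - (z_row n (laplacian_map (Delta111 n) w) x - ((5 - adj n) * z_row n w x - (z_row n w 1 + z_row n w 2 + z_row n w 3)))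
        + ((5 - adj n) * (ww x - z_row n w x) - ((w1 - z_row n w 1) + (w2 - z_row n w 2) + (w3 - z_row n w 3)))"
        by (intro dvd_add dvd_diff z1 laplacian_map_row n x dvd_mult ww w)
      moreover have "(p - (e * a - (b1 + b2 + b3))) - (l - (e * c - (d1 + d2 + d3))) + (e * (a - c) - ((b1 - d1) + (b2 - d2) + (b3 - d3)))
        = p - l" for p e a b1 b2 b3 l c d1 d2 d3 :: "int poly"
        by algebra
      ultimately show ?thesis by (simp only:)
    qed
    \<comment> \<open>Row polynomials have degree below \<open>n\<close>, so congruence modulo
      \<open>X ^ n - 1\<close> determines the entries.\<close>
    have "z = laplacian_map (Delta111 n) w"
    proof (rule extensionalityI)
      show "z \<in> extensional (pverts (Delta111 n))"
        using z by (auto simp: carrier_int_vectors PiE_def)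
      show "laplacian_map (Delta111 n) w \<in> extensional (pverts (Delta111 n))"
        by (simp add: laplacian_map_def)
      fix v assume "v \<in> pverts (Delta111 n)"
      then obtain x y where v: "v = (x, y)" "x \<in> {1, 2, 3}" "y \<in> {0..<int n}"
        by (auto simp: pverts_Delta111)
      show "z v = laplacian_map (Delta111 n) w v"
        unfolding v(1) using row_poly_cong[OF _ main[OF v(2), unfolded z_row_def] v(3)] n by simp
    qed
    then show "z \<in> laplacian_map (Delta111 n) ` carrier (int_vectors (Delta111 n))"
      using w(1) by blast
  qed
qed

section \<open>Diagonalising the lattice\<close>

definition det3 :: "int \<times> int \<times> int \<Rightarrow> int \<times> int \<times> int \<Rightarrow> int \<times> int \<times> int \<Rightarrow> int" where
  "det3 = (\<lambda>(a0, a1, a2) (b0, b1, b2) (c0, c1, c2).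
     a0 * (b1 * c2 - b2 * c1) - a1 * (b0 * c2 - b2 * c0) + a2 * (b0 * c1 - b1 * c0))"

lemma det3_linear:
  "det3 (i * a0 + j * b0 + k * c0, i * a1 + j * b1 + k * c1, i * a2 + j * b2 + k * c2) v w =
    i * det3 (a0, a1, a2) v w + j * det3 (b0, b1, b2) v w + k * det3 (c0, c1, c2) v w"
  "det3 u (i * a0 + j * b0 + k * c0, i * a1 + j * b1 + k * c1, i * a2 + j * b2 + k * c2) w =
    i * det3 u (a0, a1, a2) w + j * det3 u (b0, b1, b2) w + k * det3 u (c0, c1, c2) w"
  "det3 u v (i * a0 + j * b0 + k * c0, i * a1 + j * b1 + k * c1, i * a2 + j * b2 + k * c2) =
    i * det3 u v (a0, a1, a2) + j * det3 u v (b0, b1, b2) + k * det3 u v (c0, c1, c2)"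
  by (cases u; cases v; cases w; simp add: det3_def; simp add: algebra_simps)+

lemma det3_repeat: "det3 u u w = 0" "det3 u v u = 0" "det3 u v v = 0"
  by (cases u; cases v; cases w; simp add: det3_def; simp add: algebra_simps)+

lemma cramer_det3:
  fixes x y z :: int
  assumes "det3 (r0, r1, r2) (b0, b1, b2) (w0, w1, w2) = 1"
  defines "l1 \<equiv> det3 (x, y, z) (b0, b1, b2) (w0, w1, w2)"
    and "l2 \<equiv> det3 (r0, r1, r2) (x, y, z) (w0, w1, w2)"
    and "l3 \<equiv> det3 (r0, r1, r2) (b0, b1, b2) (x, y, z)"
  shows "x = l1 * r0 + l2 * b0 + l3 * w0" "y = l1 * r1 + l2 * b1 + l3 * w1" "z = l1 * r2 + l2 * b2 + l3 * w2"
proof -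
  have "l1 * r0 + l2 * b0 + l3 * w0 = x * det3 (r0, r1, r2) (b0, b1, b2) (w0, w1, w2)"
    "l1 * r1 + l2 * b1 + l3 * w1 = y * det3 (r0, r1, r2) (b0, b1, b2) (w0, w1, w2)"
    "l1 * r2 + l2 * b2 + l3 * w2 = z * det3 (r0, r1, r2) (b0, b1, b2) (w0, w1, w2)"
    unfolding l1_def l2_def l3_def det3_def by (simp_all only: prod.case) (simp_all only: algebra_simps)
  then show "x = l1 * r0 + l2 * b0 + l3 * w0" "y = l1 * r1 + l2 * b1 + l3 * w1" "z = l1 * r2 + l2 * b2 + l3 * w2"
    using assms(1) by simp_all
qed

text \<open>In the unimodular basis \<open>r\<close>, \<open>b\<close>, \<open>w\<close>, the
  hypotheses \<open>d\<close> and \<open>v\<close> make the components of \<open>(0, 0, n)\<close>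
  along \<open>r\<close> and \<open>b\<close> combinations of the first two rows. Removing them
  leaves a multiple of \<open>w\<close>, so the lattice is diagonal in this basis.\<close>

lemma span3_iff_dvd:
  assumes det: "det3 (r0, r1, r2) (b0, b1, b2) (w0, w1, w2) = 1"
    and d: "d dvd n" and v: "v dvd n * det3 (r0, r1, r2) (0, 0, 1) (w0, w1, w2)"
  shows "span3 (d * r0, d * r1, d * r2) (v * b0, v * b1, v * b2) (0, 0, n) x y z \<longleftrightarrow>
    d dvd det3 (x, y, z) (b0, b1, b2) (w0, w1, w2) \<and>
    v dvd det3 (r0, r1, r2) (x, y, z) (w0, w1, w2) \<and>
    n * det3 (r0, r1, r2) (b0, b1, b2) (0, 0, 1) dvd det3 (r0, r1, r2) (b0, b1, b2) (x, y, z)"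
proof -
  let ?l1 = "\<lambda>x y z. det3 (x, y, z) (b0, b1, b2) (w0, w1, w2)"
  let ?l2 = "\<lambda>x y z. det3 (r0, r1, r2) (x, y, z) (w0, w1, w2)"
  let ?l3 = "\<lambda>x y z. det3 (r0, r1, r2) (b0, b1, b2) (x, y, z)"
  obtain d' where d': "n = d * d'" using d by blast
  obtain v' where v': "n * ?l2 0 0 1 = v * v'" using v by blast
  note e3 = cramer_det3[OF det, where x = 0 and y = 0 and z = 1]
  show ?thesis
  proof
    assume "span3 (d * r0, d * r1, d * r2) (v * b0, v * b1, v * b2) (0, 0, n) x y z"
    then obtain i j k where xyz: "x = i * (d * r0) + j * (v * b0)" "y = i * (d * r1) + j * (v * b1)"
      "z = i * (d * r2) + j * (v * b2) + k * n"
      by (auto simp: span3_def)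
    have xyz': "x = (i * d) * r0 + (j * v) * b0 + (k * n) * 0" "y = (i * d) * r1 + (j * v) * b1 + (k * n) * 0"
      "z = (i * d) * r2 + (j * v) * b2 + (k * n) * 1"
      unfolding xyz by simp_all
    have l: "?l1 x y z = i * d + k * (n * ?l1 0 0 1)" "?l2 x y z = j * v + k * (n * ?l2 0 0 1)"
      "?l3 x y z = k * (n * ?l3 0 0 1)"
      unfolding xyz' det3_linear det3_repeat det by simp_all
    show "d dvd ?l1 x y z \<and> v dvd ?l2 x y z \<and> n * ?l3 0 0 1 dvd ?l3 x y z"
      unfolding l using d v by simp
  next
    assume "d dvd ?l1 x y z \<and> v dvd ?l2 x y z \<and> n * ?l3 0 0 1 dvd ?l3 x y z"
    then obtain i j k where ijk: "?l1 x y z = d * i" "?l2 x y z = v * j" "?l3 x y z = n * ?l3 0 0 1 * k"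
      by (auto elim!: dvdE)
    note c = cramer_det3[OF det, where x = x and y = y and z = z, unfolded ijk]
    \<comment> \<open>This expresses the third diagonal generator through the original rows, by
      Cramer's rule for the third unit vector.\<close>
    have w: "n * ?l3 0 0 1 * w0 = - (d * d' * ?l1 0 0 1) * r0 - (v * v') * b0"
      "n * ?l3 0 0 1 * w1 = - (d * d' * ?l1 0 0 1) * r1 - (v * v') * b1"
      "n * ?l3 0 0 1 * w2 = n - (d * d' * ?l1 0 0 1) * r2 - (v * v') * b2"
    proof -
      have "n * l3 * w = n * e - (n * l1) * r - (n * l2) * b" if "e = l1 * r + l2 * b + l3 * w"
        for e l1 r l2 b l3 w :: int
        using that by (simp add: algebra_simps)
      from this[OF e3(1)] this[OF e3(2)] this[OF e3(3)] show "n * ?l3 0 0 1 * w0 = - (d * d' * ?l1 0 0 1) * r0 - (v * v') * b0"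
        "n * ?l3 0 0 1 * w1 = - (d * d' * ?l1 0 0 1) * r1 - (v * v') * b1"
        "n * ?l3 0 0 1 * w2 = n - (d * d' * ?l1 0 0 1) * r2 - (v * v') * b2"
        unfolding v' by (simp_all add: d')
    qed
    have comb: "(i - k * d' * l) * (d * r) + (j - k * v') * (v * b) + k * e =
        d * i * r + v * j * b + N * k * w" if "N * w = e - (d * d' * l) * r - (v * v') * b"
      for l r b e N w :: int
    proof -
      have "N * k * w = k * (N * w)" by simp
      then show ?thesis unfolding that by (simp add: algebra_simps)
    qed
    show "span3 (d * r0, d * r1, d * r2) (v * b0, v * b1, v * b2) (0, 0, n) x y z"
      unfolding span3_def fst_conv snd_conv
      using comb[of "n * ?l3 0 0 1" w0 0 "?l1 0 0 1" r0 b0] comb[of "n * ?l3 0 0 1" w1 0 "?l1 0 0 1" r1 b1]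
        comb[of "n * ?l3 0 0 1" w2 n "?l1 0 0 1" r2 b2] c w
      by (intro exI[of _ "i - k * d' * ?l1 0 0 1"] exI[of _ "j - k * v'"] exI[of _ k]) simp
  qed
qed

section \<open>Arithmetic of the lattice entries, in particular at 3 and 7\<close>

lemma bezout_three:
  fixes a b c :: int
  assumes "gcd a (gcd b c) = 1"
  obtains u v w where "a * u + b * v + c * w = 1"
proof -
  obtain s t where "s * b + t * c = gcd b c" using bezout_int by blast
  moreover obtain p q where "p * a + q * gcd b c = gcd a (gcd b c)" using bezout_int by blast
  ultimately have "a * p + q * (b * s + c * t) = 1"
    using assms by (simp add: mult.commute)
  then have "a * p + b * (q * s) + c * (q * t) = 1"
    by (simp add: algebra_simps)
  then show ?thesis by (rule that)
qed

text \<open>If 3 does not divide \<open>n\<close>, it does not divide \<open>nu n\<close>, and the 3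
  in \<open>3 * C\<close> drops out of the gcd. Otherwise \<open>nu_3_power\<close> shows that
  \<open>C\<close> contains exactly one factor 3 less than \<open>n\<close>, while
  \<open>nu n\<close> contains at least as many as \<open>n\<close>; this accounts for the division
  by \<open>gcd n 3\<close>.\<close>

lemma gcd_nu_quotient:
  fixes C :: int
  assumes n: "n > 0" and C: "int n = (if odd n then 1 else 2) * int (nu n) + 3 * C"
  shows "int (gcd n (nu n) div gcd n 3) = gcd (int (nu n)) C"
proof -
  define M :: int where "M = (if odd n then 1 else 2)"
  have C: "int n = M * int (nu n) + 3 * C" using C by (simp add: M_def)
  show ?thesis
  proof (cases "3 dvd n")
    case False
    then have "coprime 3 n"
      by (intro prime_imp_coprime) auto
    then have "coprime n 3"
      by (simp only: coprime_commute)
    have "\<not> 3 dvd int (nu n)"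
    proof
      assume "3 dvd int (nu n)"
      then have "3 dvd int n" unfolding C by simp
      then show False using False by presburger
    qed
    then have "coprime 3 (int (nu n))"
      by (intro prime_imp_coprime) auto
    have "int (gcd n (nu n)) = gcd (3 * C) (int (nu n))"
      using gcd_add_mult[of "int (nu n)" M "3 * C"] by (simp add: gcd.commute flip: C)
    also have "\<dots> = gcd C (int (nu n))"
      using \<open>coprime 3 (int (nu n))\<close> by (simp add: gcd_mult_left_left_cancel coprime_commute)
    finally show ?thesis
      using \<open>coprime n 3\<close> by (simp add: gcd.commute)
  next
    case True
    obtain j where j: "n = 3 ^ multiplicity 3 n * j" "\<not> 3 dvd j"
      using multiplicity_decompose'[of n 3] n by auto
    obtain k where k: "multiplicity 3 n = Suc k"
      using True j by (cases "multiplicity 3 n") auto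
    have n3: "n = 3 ^ Suc k * j" using j(1) k by simp
    obtain u where u: "nu n = 3 ^ Suc k * u" "3 dvd int j + (if odd j then 1 else 2) * int u"
      using nu_3_power[OF j(2), of k] n3 by auto
    have "odd j = odd n" using n3 by simp
    then have ju: "3 dvd int j + M * int u" using u(2) by (simp add: M_def)
    define s where "s = int j - M * int u"
    have "3 * C = 3 * (3 ^ k * s)"
      using C unfolding u(1) by (simp add: n3 s_def algebra_simps)
    then have Cs: "C = 3 ^ k * s" by simp
    \<comment> \<open>Adding \<open>ju\<close> to \<open>s\<close> leaves \<open>2 * int j\<close>,
      which 3 does not divide.\<close>
    have "\<not> 3 dvd s"
    proof
      assume "3 dvd s"
      then have "3 dvd 2 * int j"
        using dvd_add[OF ju] by (fastforce simp: s_def)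
      then show False using j(2) by presburger
    qed
    then have cop: "coprime 3 s"
      by (intro prime_imp_coprime) auto
    have "gcd (int (nu n)) C = 3 ^ k * gcd (3 * int u) s"
    proof -
      have "int (nu n) = 3 ^ k * (3 * int u)" by (simp add: u(1))
      then show ?thesis
        unfolding Cs using gcd_mult_distrib_int[of "3 ^ k" "3 * int u" s] by simp
    qed
    also have "gcd (3 * int u) s = gcd (int u) s"
      using cop by (simp add: gcd_mult_left_left_cancel coprime_commute)
    also have "\<dots> = gcd (int u) (int j)"
      using gcd_add_mult[of "int u" M s] by (simp add: s_def)
    also have "gcd (int u) (int j) = int (gcd j u)"
      by (simp add: gcd.commute)
    finally have "gcd (int (nu n)) C = 3 ^ k * int (gcd j u)" .
    moreover have "gcd n (nu n) = 3 ^ Suc k * gcd j u"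
      unfolding u(1) by (subst (1) n3) (simp only: gcd_mult_distrib_nat)
    ultimately have "int (gcd n (nu n)) = 3 * gcd (int (nu n)) C"
      by simp
    moreover have "gcd n 3 = 3" using True by (simp add: gcd_nat.absorb2)
    ultimately show ?thesis by (simp add: zdiv_int)
  qed
qed

text \<open>Doubling \<open>v' + 5 * c'\<close> gives \<open>2 * v' + 3 * c'\<close> modulo 7, and
  this is \<open>n\<close> divided by \<open>d\<close>. If 7 divided it, \<open>n\<close> would
  contain more factors 7 than \<open>d\<close>. But for even \<open>n\<close> the power of 7 in
  \<open>n\<close> divides \<open>nu n\<close>, hence \<open>2 * c\<close>, hence
  \<open>d\<close>.\<close>

lemma coprime_7:
  fixes c :: int
  assumes n: "n > 0" "even n" "int n = 2 * (int (nu n) + 3 * c)"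
    and d: "d = gcd (int (nu n)) (2 * c)" and v': "int (nu n) = d * v'" and c': "2 * c = d * c'"
  shows "\<not> 7 dvd v' + 5 * c'"
proof
  assume "7 dvd v' + 5 * c'"
  then have "7 dvd 2 * v' + 3 * c'" by presburger
  moreover have "int n = d * (2 * v' + 3 * c')"
    using n(3) v' c' by (simp add: algebra_simps)
  ultimately have "d * 7 dvd int n" by simp
  have "d > 0" using d nu_pos[OF n(1)] by simp
  obtain k where k: "k = multiplicity 7 d" by simp
  have "7 ^ k dvd d" by (simp add: k multiplicity_dvd)
  then have "7 ^ Suc k dvd int n"
    using \<open>d * 7 dvd int n\<close> by (metis dvd_trans mult_dvd_mono dvd_refl power_Suc2)
  then have "7 ^ Suc k dvd n"
    by (metis of_nat_dvd_iff of_nat_numeral of_nat_power)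
  then obtain j where j: "n = 7 ^ Suc k * j" by blast
  then have "even j" using n(2) by simp
  then have "7 ^ Suc k dvd nu n" unfolding j by (rule nu_7_power)
  then have 1: "7 ^ Suc k dvd int (nu n)"
    by (metis of_nat_dvd_iff of_nat_numeral of_nat_power)
  have "7 ^ Suc k dvd int n - 2 * int (nu n)"
    using 1 \<open>7 ^ Suc k dvd int n\<close> by (simp only: dvd_diff dvd_mult)
  then have "7 ^ Suc k dvd 3 * (2 * c)" using n(3) by simp
  moreover have "coprime (7 ^ Suc k) (3 :: int)"
    by (intro coprime_power_left_iff[THEN iffD2] disjI1 primes_coprime) simp_all
  ultimately have "7 ^ Suc k dvd 2 * c" by (simp only: coprime_dvd_mult_right_iff)
  then have "7 ^ Suc k dvd d" unfolding d using 1 by (intro gcd_greatest)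
  moreover have "\<not> 7 ^ Suc (multiplicity 7 d) dvd d"
    using \<open>d > 0\<close> by (subst power_dvd_iff_le_multiplicity) auto
  ultimately show False by (simp add: k)
qed

text \<open>Take \<open>r\<close> as the first row divided by \<open>d\<close> and \<open>b\<close>
  as the second divided by \<open>nu n\<close>. They extend by some \<open>w\<close> to a unimodular
  basis exactly when their 2 by 2 minors have gcd 1; Bezout coefficients of the minors then give
  \<open>w\<close>.\<close>

lemma cubic_lattice_diagonal:
  fixes c :: int
  assumes n: "n > 0" and c: "int n = (if odd n then 1 else 2) * (int (nu n) + 3 * c)"
    and d: "d = gcd n (nu n) div gcd n 3"
  obtains r b w where "det3 r b w = 1"
    "\<And>x y z. (if odd n then span3 (int (nu n), 0, - c) (0, int (nu n), 0) (0, 0, int n) x y z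
        else span3 (2 * int (nu n), int (nu n), - 2 * c) (3 * int (nu n), 5 * int (nu n), int (nu n)) (0, 0, int n) x y z) \<longleftrightarrow>
      int d dvd det3 (x, y, z) b w \<and> int (nu n) dvd det3 r (x, y, z) w \<and>
      int (n * (mu n * (nu n div d))) dvd det3 r b (x, y, z)"
proof -
  define v where "v = int (nu n)"
  define C where "C = (if odd n then c else 2 * c)"
  have nC: "int n = (if odd n then 1 else 2) * v + 3 * C"
    using c by (simp add: v_def C_def)
  have dC: "int d = gcd v C"
    using gcd_nu_quotient[OF n, of C] nC by (simp add: d v_def)
  have "v > 0" using nu_pos[OF n] by (simp add: v_def)
  then have "int d > 0" by (simp add: dC)
  obtain v' where v': "v = int d * v'" unfolding dC by (metis dvdE gcd_dvd1)
  obtain C' where C': "C = int d * C'" unfolding dC by (metis dvdE gcd_dvd2)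
  have cop: "coprime v' C'"
  proof -
    have "int d * gcd v' C' = int d * 1"
      using gcd_mult_distrib_int[of "int d" v' C'] by (simp only: v'[symmetric] C'[symmetric] dC[symmetric] abs_of_nat mult_1_right)
    then show ?thesis
      using \<open>int d > 0\<close> by (simp only: mult_cancel_left coprime_iff_gcd_eq_1) simp
  qed
  have dn: "int d dvd int n"
    unfolding nC v' C' by simp
  have nv: "v dvd int n * (k * v')" for k
  proof -
    have "int d * v' dvd int n * v'" using dn by (rule mult_dvd_mono) simp
    then have "v dvd k * (int n * v')" unfolding v' by (rule dvd_mult)
    then show ?thesis by (simp add: mult.left_commute)
  qed
  have quot: "int (nu n div d) = v'"
  proof -
    have "int (nu n div d) = v div int d" by (simp add: v_def zdiv_int)
    then show ?thesis using \<open>int d > 0\<close> by (simp add: v')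
  qed
  show ?thesis
  proof (cases "odd n")
    case True
    obtain s t where st: "s * v' + t * C' = 1"
      using bezout_int[of v' C'] cop by (auto simp: coprime_iff_gcd_eq_1)
    let ?r = "(v', 0, - C')" and ?b = "(0, 1, 0)" and ?w = "(t, 0, s)"
    have det: "det3 ?r ?b ?w = 1" using st by (simp add: det3_def algebra_simps)
    show ?thesis
    proof (rule that[OF det])
      fix x y z
      have "span3 (int d * v', int d * 0, int d * - C') (v * 0, v * 1, v * 0) (0, 0, int n) x y z \<longleftrightarrow>
        int d dvd det3 (x, y, z) ?b ?w \<and> v dvd det3 ?r (x, y, z) ?w \<and>
        int n * det3 ?r ?b (0, 0, 1) dvd det3 ?r ?b (x, y, z)"
        by (rule span3_iff_dvd[OF det dn]) (use nv[of t] in \<open>simp add: det3_def algebra_simps\<close>)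
      then show "(if odd n then span3 (int (nu n), 0, - c) (0, int (nu n), 0) (0, 0, int n) x y z
        else span3 (2 * int (nu n), int (nu n), - 2 * c) (3 * int (nu n), 5 * int (nu n), int (nu n)) (0, 0, int n) x y z) \<longleftrightarrow>
        int d dvd det3 (x, y, z) ?b ?w \<and> int (nu n) dvd det3 ?r (x, y, z) ?w \<and>
        int (n * (mu n * (nu n div d))) dvd det3 ?r ?b (x, y, z)"
        using True C' by (simp add: v'[symmetric] v_def[symmetric] C_def quot mu_def det3_def)
    qed
  next
    case False
    then have C2: "2 * c = int d * C'" using C' by (simp add: C_def)
    have n7: "\<not> 7 dvd v' + 5 * C'"
    proof (rule coprime_7[OF n])
      show "int n = 2 * (int (nu n) + 3 * c)" using c False by simp
      show "int d = gcd (int (nu n)) (2 * c)" using dC False by (simp only: C_def v_def if_False)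
    qed (use False v' C2 in \<open>simp_all only: v_def not_not\<close>)
    \<comment> \<open>These are the minors of \<open>?r\<close> and \<open>?b\<close> below. A
      common divisor divides \<open>7 * v'\<close> and \<open>7 * C'\<close>, hence 7, and
      \<open>coprime_7\<close> excludes 7 itself.\<close>
    have "gcd (v' + 5 * C') (gcd (- 3 * C' - 2 * v') (7 * v')) = 1"
    proof -
      let ?g = "gcd (v' + 5 * C') (gcd (- 3 * C' - 2 * v') (7 * v'))"
      have g: "?g dvd v' + 5 * C'" "?g dvd - 3 * C' - 2 * v'" "?g dvd 7 * v'"
        by (auto intro: dvd_trans[OF gcd_dvd2])
      have "?g dvd 2 * (v' + 5 * C') + (- 3 * C' - 2 * v')"
        using dvd_add[OF dvd_mult[OF g(1), of 2] g(2)] .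
      then have "?g dvd 7 * C'" by (simp add: algebra_simps)
      then have "?g dvd gcd (7 * v') (7 * C')" using g(3) by (rule gcd_greatest[rotated])
      also have "gcd (7 * v') (7 * C') = 7"
        using gcd_mult_distrib_int[of 7 v' C'] cop by (simp add: coprime_iff_gcd_eq_1)
      finally have "?g dvd 7" .
      moreover have "prime (7 :: int)" by simp
      ultimately have "?g = 1 \<or> ?g = 7"
        by (metis gcd_ge_0_int prime_int_iff)
      then show ?thesis using g(1) n7 by metis
    qed
    then obtain w0 w1 w2 where w: "(v' + 5 * C') * w0 + (- 3 * C' - 2 * v') * w1 + 7 * v' * w2 = 1"
      by (rule bezout_three)
    let ?r = "(2 * v', v', - C')" and ?b = "(3, 5, 1)" and ?w = "(w0, w1, w2)"
    have det: "det3 ?r ?b ?w = 1" using w by (simp add: det3_def algebra_simps)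
    show ?thesis
    proof (rule that[OF det])
      fix x y z
      have "span3 (int d * (2 * v'), int d * v', int d * - C') (v * 3, v * 5, v * 1) (0, 0, int n) x y z \<longleftrightarrow>
        int d dvd det3 (x, y, z) ?b ?w \<and> v dvd det3 ?r (x, y, z) ?w \<and>
        int n * det3 ?r ?b (0, 0, 1) dvd det3 ?r ?b (x, y, z)"
        by (rule span3_iff_dvd[OF det dn]) (use nv[of "w0 - 2 * w1"] in \<open>simp add: det3_def algebra_simps\<close>)
      moreover have "(int d * (2 * v'), int d * v', int d * - C') = (2 * int (nu n), int (nu n), - 2 * c)"
        "(v * 3, v * 5, v * 1) = (3 * int (nu n), 5 * int (nu n), int (nu n))"
        using C2 v' by (simp_all add: v_def)
      moreover have "int n * det3 ?r ?b (0, 0, 1) = int (n * (mu n * (nu n div d)))"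
        using False by (simp add: det3_def quot mu_def)
      ultimately show "(if odd n then span3 (int (nu n), 0, - c) (0, int (nu n), 0) (0, 0, int n) x y z
        else span3 (2 * int (nu n), int (nu n), - 2 * c) (3 * int (nu n), 5 * int (nu n), int (nu n)) (0, 0, int n) x y z) \<longleftrightarrow>
        int d dvd det3 (x, y, z) ?b ?w \<and> int (nu n) dvd det3 ?r (x, y, z) ?w \<and>
        int (n * (mu n * (nu n div d))) dvd det3 ?r ?b (x, y, z)"
        using False by (simp only: if_False v_def)
    qed
  qed
qed

section \<open>Assembling the isomorphism\<close>

lemma z_row_add:
  "v \<in> {1, 2, 3} \<Longrightarrow> z_row n (z \<otimes>\<^bsub>int_vectors (Delta111 n)\<^esub> w) v = z_row n z v + z_row n w v"
  unfolding z_row_def row_poly_def mult_int_vectors sum.distrib[symmetric]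
  by (rule sum.cong) (auto simp: pverts_Delta111 distrib_right)

text \<open>The quadratic modulus contributes the coordinates modulo \<open>nu n\<close> and
  \<open>3 * mu n * nu n\<close>. The quartic one contributes those modulo \<open>d\<close>,
  \<open>nu n\<close> and \<open>n * (mu n * (nu n div d))\<close>, and its value at 1 is the
  integer coordinate.\<close>

lemma Jac_Delta111_iso:
  assumes n: "n \<ge> 3" and d: "d = gcd n (nu n) div gcd n 3"
  shows "Jac (Delta111 n) \<cong>
    integer_mod_group d \<times>\<times> (integer_mod_group (nu n) \<times>\<times> integer_mod_group (nu n)) \<times>\<times>
    integer_mod_group (3 * mu n * nu n) \<times>\<times> integer_mod_group (n * (mu n * (nu n div d)))"
proof -
  let ?G = "int_vectors (Delta111 n)" and ?N = "X ^ n - 1" and ?P = "(X - 1) * Q * (X - 1)"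
  let ?v = "int (nu n)" and ?m = "3 * mu n * nu n" and ?D = "n * (mu n * (nu n div d))"
  let ?H = "integer_mod_group d \<times>\<times> (integer_mod_group (nu n) \<times>\<times> integer_mod_group (nu n)) \<times>\<times>
    integer_mod_group ?m \<times>\<times> integer_mod_group ?D"
  have n0: "n > 0" using n by simp
  define c where "c = (if odd n then int n - ?v else int n div 2 - ?v) div 3"
  have c: "int n = (if odd n then 1 else 2) * (?v + 3 * c)"
    using nu_mod_3[of n] by (auto simp: c_def split: if_splits) presburger+
  obtain j where j: "(X - 1) * Q dvd (\<Sum>i<n. X ^ i) - X ^ j * (kappa n * (of_int ?v - of_int c * Q))"
    using geometric_sum_nu[OF n0 c] by blast
  have N: "?N = (\<Sum>i<n. X ^ i) * (X - 1)"
    by (simp only: power_diff_1_eq mult.commute)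
  \<comment> \<open>The remainder coordinates are chosen as functions; uniqueness of remainders
    later yields their additivity and their values on reduced polynomials.\<close>
  obtain a b where ab: "\<And>f. Q dvd f - (of_int (a f) + of_int (b f) * X)"
    using linear_remainder by metis
  obtain del cx cy cz where cub: "\<And>f. ?P dvd f - cubic (del f) (cx f) (cy f) (cz f)"
    using cubic_remainder by metis
  obtain r s w where rsw: "det3 r s w = 1"
    "\<And>x y z. (if odd n then span3 (?v, 0, - c) (0, ?v, 0) (0, 0, int n) x y z
        else span3 (2 * ?v, ?v, - 2 * c) (3 * ?v, 5 * ?v, ?v) (0, 0, int n) x y z) \<longleftrightarrow>
      int d dvd det3 (x, y, z) s w \<and> ?v dvd det3 r (x, y, z) w \<and> int ?D dvd det3 r s (x, y, z)"
    using cubic_lattice_diagonal[OF n0 c d] by blast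
  define l1 where "l1 f = det3 (cx f, cy f, cz f) s w" for f
  define l2 where "l2 f = det3 r (cx f, cy f, cz f) w" for f
  define l3 where "l3 f = det3 r s (cx f, cy f, cz f)" for f

  have lin: "(\<exists>A B. f = A * Q + B * ?N) \<longleftrightarrow> ?v dvd b f \<and> int ?m dvd a f + 13 * b f" for f
  proof -
    have "Q dvd ((\<Sum>i<n. X ^ i) - X ^ j * (kappa n * (of_int ?v - of_int c * Q))) * (X - 1)"
      by (intro dvd_mult2 dvd_mult_right[OF j])
    moreover have "(p - u * h) * y = p * y - u * (y * h)" for p u h y :: "int poly"
      by (simp add: algebra_simps)
    ultimately have 1: "Q dvd ?N - X ^ j * ((X - 1) * (kappa n * (of_int ?v - of_int c * Q)))"
      unfolding N by (simp only:)
    show ?thesis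
      using ideal_times_unit[OF 1 dvd_mult_right[OF X_unit], of f 1] linear_criterion[OF ab, of f n ?v c]
      by (simp only: mult_1_right of_nat_mult)
  qed
  have cubc: "(\<exists>A B. f = A * ?P + B * ?N) \<longleftrightarrow> del f = 0 \<and> int d dvd l1 f \<and> ?v dvd l2 f \<and> int ?D dvd l3 f" for f
    unfolding N ideal_times_unit[OF j X_unit] cubic_criterion[OF c cub] rsw(2) l1_def l2_def l3_def ..

  have ab_add: "a (f + g) = a f + a g" "b (f + g) = b f + b g" for f g
  proof -
    have "Q dvd (f - (of_int (a f) + of_int (b f) * X)) + (g - (of_int (a g) + of_int (b g) * X))
      - ((f + g) - (of_int (a (f + g)) + of_int (b (f + g)) * X))"
      by (intro dvd_add dvd_diff ab)
    moreover have "(f - (p + q * x)) + (g - (p' + q' * x)) - ((f + g) - (p'' + q'' * x)) =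
      (p'' - (p + p')) + (q'' - (q + q')) * x" for f g p q x p' q' p'' q'' :: "int poly"
      by (simp add: algebra_simps)
    ultimately have "Q dvd of_int (a (f + g) - (a f + a g)) + of_int (b (f + g) - (b f + b g)) * X"
      by (simp only: of_int_diff of_int_add)
    from linear_unique[OF this] show "a (f + g) = a f + a g" "b (f + g) = b f + b g" by simp_all
  qed
  have ab_eval: "a (of_int i + of_int k * X) = i" "b (of_int i + of_int k * X) = k" for i k
  proof -
    let ?f = "of_int i + of_int k * X"
    have "of_int i + of_int k * X - (of_int (a ?f) + of_int (b ?f) * X) = of_int (i - a ?f) + of_int (k - b ?f) * X"
      by (simp only: of_int_diff left_diff_distrib add_diff_add)
    then have "Q dvd of_int (i - a ?f) + of_int (k - b ?f) * X" using ab[of ?f] by (simp only:)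
    from linear_unique[OF this] show "a ?f = i" "b ?f = k" by (simp_all only: right_minus_eq)
  qed
  have cub_ring: "(d + (x + y * (t - 1) + z * q) * (t - 1)) + (d' + (x' + y' * (t - 1) + z' * q) * (t - 1)) =
      (d + d') + ((x + x') + (y + y') * (t - 1) + (z + z') * q) * (t - 1)"
      "(d + (x + y * (t - 1) + z * q) * (t - 1)) - (d' + (x' + y' * (t - 1) + z' * q) * (t - 1)) =
      (d - d') + ((x - x') + (y - y') * (t - 1) + (z - z') * q) * (t - 1)"
    for d x y z d' x' y' z' t q :: "int poly"
    by (simp_all add: algebra_simps)
  have cub_add: "del (f + g) = del f + del g" "cx (f + g) = cx f + cx g" "cy (f + g) = cy f + cy g" "cz (f + g) = cz f + cz g" for f g
  proof -
    have "?P dvd (f - cubic (del f) (cx f) (cy f) (cz f)) + (g - cubic (del g) (cx g) (cy g) (cz g))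
      - ((f + g) - cubic (del (f + g)) (cx (f + g)) (cy (f + g)) (cz (f + g)))"
      by (intro dvd_add dvd_diff cub)
    moreover have "(f - p) + (g - p') - ((f + g) - p'') = p'' - (p + p')" for f g p p' p'' :: "int poly"
      by (simp add: algebra_simps)
    ultimately have "?P dvd cubic (del (f + g) - (del f + del g)) (cx (f + g) - (cx f + cx g))
        (cy (f + g) - (cy f + cy g)) (cz (f + g) - (cz f + cz g))"
      by (simp only: of_int_diff of_int_add cub_ring)
    from cubic_unique[OF this] show "del (f + g) = del f + del g" "cx (f + g) = cx f + cx g"
      "cy (f + g) = cy f + cy g" "cz (f + g) = cz f + cz g" by (simp_all only: right_minus_eq)
  qed
  have cub_eval: "del (cubic i x y z) = i" "cx (cubic i x y z) = x" "cy (cubic i x y z) = y" "cz (cubic i x y z) = z" for i x y z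
  proof -
    let ?f = "cubic i x y z"
    have "?P dvd cubic (i - del ?f) (x - cx ?f) (y - cy ?f) (z - cz ?f)"
      using cub[of ?f] by (simp only: of_int_diff cub_ring)
    from cubic_unique[OF this] show "del ?f = i" "cx ?f = x" "cy ?f = y" "cz ?f = z"
      by (simp_all only: right_minus_eq)
  qed
  have l_add: "l1 (f + g) = l1 f + l1 g" "l2 (f + g) = l2 f + l2 g" "l3 (f + g) = l3 f + l3 g" for f g
    unfolding l1_def l2_def l3_def cub_add
    using det3_linear(1)[of 1 "cx f" 1 "cx g" 0 0 "cy f" "cy g" 0 "cz f" "cz g" 0 s w]
      det3_linear(2)[of r 1 "cx f" 1 "cx g" 0 0 "cy f" "cy g" 0 "cz f" "cz g" 0 w]
      det3_linear(3)[of r s 1 "cx f" 1 "cx g" 0 0 "cy f" "cy g" 0 "cz f" "cz g" 0]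
    by simp_all

  \<comment> \<open>The coordinates of \<open>z\<close> with respect to the generators \<open>u\<close> and \<open>v\<^sub>1\<close>, using \<open>v\<^sub>3 = v\<^sub>1 + (2 - T - T\<^sup>-\<^sup>1) v\<^sub>1 - u\<close>.\<close>
  define F where "F z = z_row n z 2 - z_row n z 3" for z
  define S where "S z = z_row n z 1 + z_row n z 2 + z_row n z 3 + (2 - adj n) * z_row n z 3" for z
  have F_add: "F (z \<otimes>\<^bsub>?G\<^esub> z') = F z + F z'" and S_add: "S (z \<otimes>\<^bsub>?G\<^esub> z') = S z + S z'" for z z'
    unfolding F_def S_def by (simp_all add: z_row_add algebra_simps)
  define psi where "psi z = (l1 (S z) mod int d, (b (F z) mod int (nu n), l2 (S z) mod int (nu n)),
    (a (F z) + 13 * b (F z)) mod int ?m, l3 (S z) mod int ?D)" for z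
  have "d > 0"
  proof (rule ccontr)
    assume "\<not> d > 0"
    moreover have "gcd n 3 * d = gcd n (nu n)"
      unfolding d by (rule dvd_mult_div_cancel[OF gcd_3_dvd_gcd_nu])
    ultimately show False using n0 by simp
  qed
  have dnu: "d dvd nu n"
    unfolding d using gcd_3_dvd_gcd_nu[of n] by (metis dvd_div_mult_self dvd_triv_left dvd_trans gcd_dvd2)
  have pos: "d > 0" "nu n > 0" "?m > 0" "?D > 0"
    using \<open>d > 0\<close> nu_pos[OF n0] n0 dnu by (auto simp: mu_def dvd_div_eq_0_iff)

  have grpH: "group ?H" by (intro DirProd_group group_integer_mod_group)
  \<comment> \<open>A common multiple of the orders of all five cyclic factors.\<close>
  let ?e = "d * nu n * ?m * ?D"
  have e: "?e > 0" using pos by simp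
  have expH: "h [^]\<^bsub>?H\<^esub> ?e = \<one>\<^bsub>?H\<^esub>" for h
  proof -
    have "int ?e * x mod int k = 0" if "k dvd ?e" for x k
    proof -
      have "int k dvd int ?e" using that by (simp only: of_nat_dvd_iff)
      then show ?thesis by (simp only: dvd_mult2 mod_0_imp_dvd dvd_imp_mod_0)
    qed
    note this[of d] this[of "nu n"] this[of ?m] this[of ?D]
    moreover obtain h1 h2 h3 h4 h5 where "h = (h1, (h2, h3), h4, h5)" by (cases h) auto
    ultimately show ?thesis
      by (simp only: DirProd_nat_pow pow_integer_mod_group one_DirProd one_integer_mod_group
        dvd_triv_left dvd_triv_right dvd_mult dvd_mult2 prod.inject)
  qed
  have psi_hom: "psi \<in> hom ?G ?H"
  proof (rule homI)
    show "psi z \<in> carrier ?H" for z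
      using pos by (simp add: psi_def carrier_integer_mod_group)
    show "psi (z \<otimes>\<^bsub>?G\<^esub> z') = psi z \<otimes>\<^bsub>?H\<^esub> psi z'" for z z'
      by (simp add: psi_def F_add S_add l_add ab_add mod_add_eq algebra_simps)
  qed
  have del_hom: "(\<lambda>z. del (S z)) \<in> hom ?G integer_group"
    by (auto simp: hom_def S_add cub_add)
  have ker: "laplacian_map (Delta111 n) ` carrier ?G = {z \<in> carrier ?G. psi z = \<one>\<^bsub>?H\<^esub> \<and> del (S z) = 0}"
  proof -
    have "laplacian_map (Delta111 n) ` carrier ?G \<subseteq> carrier ?G"
      using laplacian_map_hom[of "Delta111 n"] by (auto simp: hom_def)
    moreover have "z \<in> laplacian_map (Delta111 n) ` carrier ?G \<longleftrightarrow> psi z = \<one>\<^bsub>?H\<^esub> \<and> del (S z) = 0"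
      if "z \<in> carrier ?G" for z
      unfolding laplacian_image_iff[OF n that] F_def[symmetric] S_def[symmetric] lin cubc
      by (auto simp: psi_def mod_eq_0_iff_dvd)
    ultimately show ?thesis by blast
  qed
  have surj: "\<exists>z\<in>carrier ?G. psi z = h \<and> del (S z) = k" if h: "h \<in> carrier ?H" for h k
  proof -
    obtain h1 h2 h3 h4 h5 where hh: "h = (h1, (h2, h3), h4, h5)" by (cases h) auto
    have hr: "h1 mod int d = h1" "h2 mod int (nu n) = h2" "h3 mod int (nu n) = h3" "h4 mod int ?m = h4" "h5 mod int ?D = h5"
      using h pos by (auto simp: hh carrier_integer_mod_group simp del: of_nat_mult)
    obtain r0 r1 r2 s0 s1 s2 w0 w1 w2 where rsw': "r = (r0, r1, r2)" "s = (s0, s1, s2)" "w = (w0, w1, w2)"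
      by (cases r, cases s, cases w) auto
    \<comment> \<open>\<open>f0\<close> solves \<open>b = h2\<close>,
      \<open>a + 13 * b = h4\<close>. \<open>S0\<close> has value \<open>k\<close> at 1 and
      components \<open>h1\<close>, \<open>h3\<close>, \<open>h5\<close> along \<open>r\<close>,
      \<open>s\<close>, \<open>w\<close>, which the determinants read off.\<close>
    define f0 where "f0 = of_int (h4 - 13 * h2) + of_int h2 * X"
    define S0 where "S0 = cubic k (h1 * r0 + h3 * s0 + h5 * w0) (h1 * r1 + h3 * s1 + h5 * w1) (h1 * r2 + h3 * s2 + h5 * w2)"
    have f0: "a f0 + 13 * b f0 = h4" "b f0 = h2"
      unfolding f0_def ab_eval by simp_all
    have S0: "del S0 = k" "l1 S0 = h1" "l2 S0 = h3" "l3 S0 = h5"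
      unfolding S0_def l1_def l2_def l3_def cub_eval rsw'
      unfolding det3_linear det3_repeat rsw(1)[unfolded rsw'] by simp_all
    \<comment> \<open>With third row 0, \<open>F\<close> is the second row and \<open>S\<close> the
      sum of the first two, so these rows realise \<open>f0\<close> and \<open>S0\<close> modulo
      \<open>?N\<close>.\<close>
    obtain z where z: "z \<in> carrier ?G" "?N dvd (S0 - f0) - z_row n z 1" "?N dvd f0 - z_row n z 2" "?N dvd 0 - z_row n z 3"
      using vector_exists[OF n0, of "S0 - f0" f0 0] by blast
    have "?N dvd (0 - z_row n z 3) - (f0 - z_row n z 2)"
      by (intro dvd_diff z)
    moreover have "(0 - p3) - (f - p2) = (p2 - p3) - f" for p2 p3 f :: "int poly" by (simp add: algebra_simps)
    ultimately have "?N dvd F z - f0" by (simp only: F_def)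
    then obtain kf where kf: "F z - f0 = ?N * kf" by (rule dvdE)
    have "?N dvd - ((S0 - f0) - z_row n z 1) - (f0 - z_row n z 2) - (0 - z_row n z 3) - (2 - adj n) * (0 - z_row n z 3)"
      by (intro dvd_diff dvd_mult z) (simp only: dvd_minus_iff z)
    moreover have "- ((s - f) - p1) - (f - p2) - (0 - p3) - e * (0 - p3) = (p1 + p2 + p3 + e * p3) - s"
      for s f p1 p2 p3 e :: "int poly"
      by (simp add: algebra_simps)
    ultimately have "?N dvd S z - S0" by (simp only: S_def)
    then obtain ks where ks: "S z - S0 = ?N * ks" by (rule dvdE)
    \<comment> \<open>Multiples of \<open>?N\<close> lie in both ideals, so the discrepancy does not
      affect the residue coordinates or \<open>del\<close>.\<close>
    have "\<exists>A B. F z - f0 = A * Q + B * ?N" "\<exists>A B. S z - S0 = A * ?P + B * ?N"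
      unfolding kf ks by (intro exI[of _ 0] exI[of _ kf] exI[of _ ks], simp only: mult_zero_left add_0_left mult.commute)+
    then have diff: "?v dvd b (F z - f0)" "int ?m dvd a (F z - f0) + 13 * b (F z - f0)" "del (S z - S0) = 0"
      "int d dvd l1 (S z - S0)" "?v dvd l2 (S z - S0)" "int ?D dvd l3 (S z - S0)"
      unfolding lin cubc by blast+
    have split: "F z = f0 + (F z - f0)" "S z = S0 + (S z - S0)" by simp_all
    have "psi z = h"
    proof -
      have "(p + q) mod m = p" if "p mod m = p" "m dvd q" for p q m :: int
        using that by (metis add.right_neutral mod_add_right_eq mod_eq_0_iff_dvd)
      note red = this[OF hr(1) diff(4)] this[OF hr(2) diff(1)] this[OF hr(3) diff(5)] this[OF hr(4) diff(2)] this[OF hr(5) diff(6)]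
      have "l1 (S z) = h1 + l1 (S z - S0)" "l2 (S z) = h3 + l2 (S z - S0)" "l3 (S z) = h5 + l3 (S z - S0)"
        "b (F z) = h2 + b (F z - f0)" "a (F z) + 13 * b (F z) = h4 + (a (F z - f0) + 13 * b (F z - f0))"
        using l_add[of S0 "S z - S0"] ab_add[of f0 "F z - f0"] S0 f0 by simp_all
      then show ?thesis unfolding psi_def hh by (simp only: red)
    qed
    moreover have "del (S z) = k"
      using cub_add(1)[of S0 "S z - S0"] S0(1) diff(3) by simp
    ultimately show ?thesis using z(1) by blast
  qed
  have "group ?G" using comm_group_int_vectors by (rule comm_group.axioms(2))
  from torsion_FactGroup_iso[OF this grpH e expH psi_hom del_hom ker surj]
  show ?thesis unfolding Jac_def laplacian_coker_def .
qed

theorem theorem2: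
  fixes n :: nat
  assumes "n \<ge> 3"
  shows "Jac (Delta111 n) \<cong>
    integer_mod_group (gcd n (nu n) div gcd n 3) \<times>\<times>
    (integer_mod_group (nu n) \<times>\<times> integer_mod_group (nu n)) \<times>\<times>
    integer_mod_group (mu_hat n * nu n) \<times>\<times>
    integer_mod_group (3 * mu n * lcm n (nu n))"
proof -
  define d where "d = gcd n (nu n) div gcd n 3"
  let ?A = "integer_mod_group d" and ?B = "integer_mod_group (nu n) \<times>\<times> integer_mod_group (nu n)"
  have gd: "gcd n 3 * d = gcd n (nu n)"
    using gcd_3_dvd_gcd_nu[of n] by (simp add: d_def)
  have "d dvd nu n" using gd by (metis dvd_triv_right dvd_trans gcd_dvd2)
  \<comment> \<open>Multiplying by \<open>d\<close> reduces this to the product of gcd and lcm being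
    \<open>n * nu n\<close>.\<close>
  then have lcm: "n * (nu n div d) = gcd n 3 * lcm n (nu n)"
  proof -
    have "d * (n * (nu n div d)) = n * nu n"
      using \<open>d dvd nu n\<close> by simp
    also have "\<dots> = d * (gcd n 3 * lcm n (nu n))"
      using prod_gcd_lcm_nat[of n "nu n"] unfolding gd[symmetric] by (simp add: algebra_simps)
    finally show ?thesis
      using gd assms by (cases "d = 0") auto
  qed
  have J: "Jac (Delta111 n) \<cong> ?A \<times>\<times> ?B \<times>\<times>
    integer_mod_group (3 * mu n * nu n) \<times>\<times> integer_mod_group (mu n * (gcd n 3 * lcm n (nu n)))"
  proof -
    have "n * (mu n * (nu n div d)) = mu n * (gcd n 3 * lcm n (nu n))"
      by (simp only: lcm mult.left_commute[of n])
    then show ?thesis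
      using Jac_Delta111_iso[OF assms d_def] by (simp only:)
  qed
  show ?thesis
  proof (cases "3 dvd n")
    case True
    \<comment> \<open>Here the orders in \<open>J\<close> already agree with the claimed
      ones.\<close>
    then have "gcd n 3 = 3" by (simp add: gcd_nat.absorb2)
    then show ?thesis using J by (simp add: d_def mu_hat_def mult.left_commute mult.assoc)
  next
    case False
    then have cop: "coprime 3 n" by (intro prime_imp_coprime) auto
    then have g: "gcd n 3 = 1" by (simp add: coprime_iff_gcd_eq_1 gcd.commute)
    have "\<not> 3 dvd nu n"
    proof
      assume "3 dvd nu n"
      then have "3 dvd int (nu n)" by presburger
      then have "3 dvd int n"
        using nu_mod_3[of n] by (metis dvd_diff_right_iff dvd_mult dvd_diff_commute)
      then show False using False by presburger
    qed
    \<comment> \<open>Now \<open>J\<close> has an extra factor 3 in the fourth summand, whereas the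
      claim has it in the fifth. All cofactors are prime to 3, so the Chinese remainder theorem
      splits it off and \<open>DirProd_rotate_iso\<close> moves it across.\<close>
    then have cv: "coprime 3 (nu n)" by (intro prime_imp_coprime) auto
    have c3: "coprime 3 (mu n)"
      by (simp add: mu_def) (intro impI primes_coprime, simp_all)
    have cl: "coprime 3 (lcm n (nu n))"
      by (rule coprime_divisors[of 3 3 _ "n * nu n"]) (use cop cv in \<open>auto intro: lcm_least\<close>)
    let ?a = "mu n * nu n" and ?b = "mu n * lcm n (nu n)"
    have pos: "?a > 0" "?b > 0"
      using nu_pos[of n] assms by (auto simp: mu_def lcm_pos_nat)
    have iso3: "integer_mod_group (3 * k) \<cong> integer_mod_group 3 \<times>\<times> integer_mod_group k"
      if "coprime 3 k" "k > 0" for k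
      using that by (intro integer_mod_group_mult_iso) auto
    have "coprime 3 ?a" "coprime 3 ?b" using c3 cv cl by simp_all
    note iso3 = iso3[OF this(1) pos(1)] iso3[OF this(2) pos(2)]
    have "integer_mod_group (3 * ?a) \<times>\<times> integer_mod_group ?b \<cong>
      (integer_mod_group 3 \<times>\<times> integer_mod_group ?a) \<times>\<times> integer_mod_group ?b"
      by (rule group.DirProd_iso_trans[OF _ iso3(1) iso_refl]) simp
    also have "\<dots> \<cong> integer_mod_group ?a \<times>\<times> integer_mod_group 3 \<times>\<times> integer_mod_group ?b"
      by (rule DirProd_rotate_iso)
    also have "\<dots> \<cong> integer_mod_group ?a \<times>\<times> integer_mod_group (3 * ?b)"
      by (rule group.DirProd_iso_trans[OF _ iso_refl group.iso_sym[OF _ iso3(2)]]) simp_all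
    finally have swap: "integer_mod_group (3 * ?a) \<times>\<times> integer_mod_group ?b \<cong>
      integer_mod_group ?a \<times>\<times> integer_mod_group (3 * ?b)" .
    have "group ?A" "group ?B" by (simp_all add: DirProd_group)
    then have "?A \<times>\<times> ?B \<times>\<times> integer_mod_group (3 * ?a) \<times>\<times> integer_mod_group ?b \<cong>
      ?A \<times>\<times> ?B \<times>\<times> integer_mod_group ?a \<times>\<times> integer_mod_group (3 * ?b)"
      by (rule group.DirProd_iso_trans[OF _ iso_refl group.DirProd_iso_trans[OF _ iso_refl swap]])
    from iso_trans[OF J[unfolded g mult_1_left mult.assoc] this] show ?thesis
      by (simp only: d_def mu_hat_def g mult_1_left mult.assoc)
  qed
qed

end
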